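(* Let $N\ge3$ and let $\Omega\subset\mathbb{R}^N$ be a bounded domain containing $0$. The spaces $H(\Omega)$ and $\mathcal{H}(\Omega)$ coincide.
   Context: $H=H(\Omega)$ is the completion of $C_0^\infty(\Omega)$ under the norm $$\|\phi\|_H^2=I_\Omega[\phi]=\int_\Omega|\nabla\phi|^2\,dx-\Big(\frac{N-2}{2}\Big)^2\int_\Omega\frac{\phi^2}{|x|^2}\,dx,\qquad \phi\in C_0^\infty(\Omega).$$ $\mathcal H=\mathcal H(\Omega)$ is the completion of the set $\{u=|x|^{-\frac{N-2}{2}}v:\ v\in C_0^\infty(\Omega)\}$ under the norm $$\|u\|_{\mathcal H}^2=\int_\Omega|x|^{-(N-2)}\big|\nabla(|x|^{\frac{N-2}{2}}u)\big|^2\,dx .$$ Both completions are regarded as spaces of functions on $\Omega$ (they embed continuously in $L^2(\Omega)$). *)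

theory Defs
  imports "HOL-Analysis.Analysis"
begin

primrec Ck :: "nat \<Rightarrow> ('a::euclidean_space \<Rightarrow> real) \<Rightarrow> bool" where
  "Ck 0 f \<longleftrightarrow> continuous_on UNIV f"
| "Ck (Suc k) f \<longleftrightarrow> (\<forall>x. f differentiable (at x)) \<and>
     (\<forall>b\<in>Basis. Ck k (\<lambda>x. frechet_derivative f (at x) b))"

text \<open>\<open>C\<^sub>0\<^sup>\<infinity>(\<Omega>)\<close>; a test function on \<open>\<Omega>\<close> is represented by its extension by zero to the whole space.\<close>

definition test_functions :: "'a::euclidean_space set \<Rightarrow> ('a \<Rightarrow> real) set" where
  "test_functions \<Omega> = {\<phi>. (\<forall>k. Ck k \<phi>) \<and> compact (closure {x. \<phi> x \<noteq> 0}) \<and> closure {x. \<phi> x \<noteq> 0} \<subseteq> \<Omega>}"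

definition grad :: "('a::euclidean_space \<Rightarrow> real) \<Rightarrow> 'a \<Rightarrow> 'a" where
  "grad f x = (\<Sum>b\<in>Basis. frechet_derivative f (at x) b *\<^sub>R b)"

definition L2_functions :: "'a::euclidean_space set \<Rightarrow> ('a \<Rightarrow> real) set" where
  "L2_functions \<Omega> = {u. u \<in> borel_measurable (lebesgue_on \<Omega>) \<and> integrable (lebesgue_on \<Omega>) (\<lambda>x. (u x)\<^sup>2)}"

text \<open>
  The completion of \<open>(X, nrm)\<close> as a space of functions on \<open>\<Omega>\<close>: its elements are represented by
  the \<open>nrm\<close>-Cauchy sequences in \<open>X\<close>, and such a sequence is identified with its limit in
  \<open>L\<^sup>2(\<Omega>)\<close>. The norm of the element is the limit of the norms along the sequence;
  it does not depend on the sequence because the completion embeds injectively in \<open>L\<^sup>2(\<Omega>)\<close>.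
  The sets of functions below are closed under equality almost everywhere on \<open>\<Omega>\<close> (values
  outside \<open>\<Omega>\<close> are irrelevant), so that equality of such sets is equality of the corresponding
  spaces of equivalence classes.
\<close>

definition completion_seq ::
  "('a::euclidean_space \<Rightarrow> real) set \<Rightarrow> (('a \<Rightarrow> real) \<Rightarrow> real) \<Rightarrow> 'a set
    \<Rightarrow> (nat \<Rightarrow> 'a \<Rightarrow> real) \<Rightarrow> ('a \<Rightarrow> real) \<Rightarrow> bool" where
  "completion_seq X nrm \<Omega> s u \<longleftrightarrow>
     (\<forall>n. s n \<in> X) \<and>
     (\<forall>e>0. \<exists>M. \<forall>m\<ge>M. \<forall>n\<ge>M. nrm (\<lambda>x. s m x - s n x) < e) \<and>
     u \<in> L2_functions \<Omega> \<and>
     (\<lambda>n. LINT x|lebesgue_on \<Omega>. (s n x - u x)\<^sup>2) \<longlonglongrightarrow> 0"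

definition completion_space ::
  "('a::euclidean_space \<Rightarrow> real) set \<Rightarrow> (('a \<Rightarrow> real) \<Rightarrow> real) \<Rightarrow> 'a set \<Rightarrow> ('a \<Rightarrow> real) set" where
  "completion_space X nrm \<Omega> = {u. \<exists>s. completion_seq X nrm \<Omega> s u}"

definition completion_norm ::
  "('a::euclidean_space \<Rightarrow> real) set \<Rightarrow> (('a \<Rightarrow> real) \<Rightarrow> real) \<Rightarrow> 'a set \<Rightarrow> ('a \<Rightarrow> real) \<Rightarrow> real" where
  "completion_norm X nrm \<Omega> u =
     (THE r. \<exists>s. completion_seq X nrm \<Omega> s u \<and> (\<lambda>n. nrm (s n)) \<longlonglongrightarrow> r)"

definition hardy_functional :: "'a::euclidean_space set \<Rightarrow> ('a \<Rightarrow> real) \<Rightarrow> real" where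
  "hardy_functional \<Omega> \<phi> =
     (LINT x|lebesgue_on \<Omega>. (norm (grad \<phi> x))\<^sup>2)
     - ((real DIM('a) - 2) / 2)\<^sup>2 * (LINT x|lebesgue_on \<Omega>. (\<phi> x)\<^sup>2 / (norm x)\<^sup>2)"

definition H_prenorm :: "'a::euclidean_space set \<Rightarrow> ('a \<Rightarrow> real) \<Rightarrow> real" where
  "H_prenorm \<Omega> \<phi> = sqrt (hardy_functional \<Omega> \<phi>)"

definition H_space :: "'a::euclidean_space set \<Rightarrow> ('a \<Rightarrow> real) set" where
  "H_space \<Omega> = completion_space (test_functions \<Omega>) (H_prenorm \<Omega>) \<Omega>"

definition H_norm :: "'a::euclidean_space set \<Rightarrow> ('a \<Rightarrow> real) \<Rightarrow> real" where
  "H_norm \<Omega> = completion_norm (test_functions \<Omega>) (H_prenorm \<Omega>) \<Omega>"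

text \<open>
  Since \<open>0 powr a = 0\<close>, the functions \<open>|x|\<^sup>a u\<close> below may be discontinuous at the origin;
  this affects the integrands only on a null set.
\<close>

definition calH_core :: "'a::euclidean_space set \<Rightarrow> ('a \<Rightarrow> real) set" where
  "calH_core \<Omega> = (\<lambda>v x. norm x powr (- ((real DIM('a) - 2) / 2)) * v x) ` test_functions \<Omega>"

definition calH_prenorm :: "'a::euclidean_space set \<Rightarrow> ('a \<Rightarrow> real) \<Rightarrow> real" where
  "calH_prenorm \<Omega> u =
     sqrt (LINT x|lebesgue_on \<Omega>. norm x powr (- (real DIM('a) - 2)) *
       (norm (grad (\<lambda>y. norm y powr ((real DIM('a) - 2) / 2) * u y) x))\<^sup>2)"

definition calH_space :: "'a::euclidean_space set \<Rightarrow> ('a \<Rightarrow> real) set" where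
  "calH_space \<Omega> = completion_space (calH_core \<Omega>) (calH_prenorm \<Omega>) \<Omega>"

definition calH_norm :: "'a::euclidean_space set \<Rightarrow> ('a \<Rightarrow> real) \<Rightarrow> real" where
  "calH_norm \<Omega> = completion_norm (calH_core \<Omega>) (calH_prenorm \<Omega>) \<Omega>"

end

theory Submission
  imports Defs
begin

text \<open>
  Write \<open>N\<close> for the dimension and \<open>a = (N - 2) / 2\<close>. The proof compares both spaces with the completion of
  the test functions on \<open>\<Omega> - {0}\<close>, under the one prenorm \<open>calH_prenorm\<close>.

  On test functions on \<open>\<Omega>\<close> the two prenorms agree (\<open>H_prenorm_eq_calH_prenorm\<close>). This is the ground-state
  substitution \<open>v = |x| powr a * \<phi>\<close>: in the expansion of \<open>|x| powr (-2 a) * |\<nabla>v|\<^sup>2\<close> the integral of the cross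
  term is computed by differentiating along dilations (\<open>integral_inverse_square_radial_derivative\<close>).

  The two cores are different. If \<open>v 0 \<noteq> 0\<close>, then both integrals in the Hardy functional of
  \<open>|x| powr (-a) * v\<close> diverge, and \<open>|x| powr a * \<phi>\<close> is in general not smooth for a test function \<open>\<phi>\<close>. But both
  cores contain the test functions on \<open>\<Omega> - {0}\<close>, and both lie in the vector space \<open>hardy_class\<close>, on which
  \<open>calH_prenorm\<close> is a seminorm. In this class the test functions on \<open>\<Omega> - {0}\<close> are dense
  (\<open>hardy_class_approx\<close>): after the substitution, the weight \<open>|x| powr (-(N - 2))\<close> makes the origin behave
  like a point in the plane, which has zero capacity, and a logarithmic cutoff removes it.

  Passing to a dense subset changes neither the completion nor its norm (\<open>completion_dense_subset\<close>), so both
  spaces equal the completion of the common dense subset.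
\<close>

section \<open>Smooth functions on open sets\<close>

text \<open>
  The ground-state factor \<open>|x|\<^sup>a\<close> is smooth only away from the origin, so smoothness has to be
  available on open subsets; on the whole space it is the class \<open>Ck\<close>. One induction on the order proves
  each closure property, because the partial derivatives of a sum, product or composition are again
  built by these operations.
\<close>

primrec Ck_on :: "nat \<Rightarrow> 'a set \<Rightarrow> ('a::euclidean_space \<Rightarrow> real) \<Rightarrow> bool" where
  "Ck_on 0 U f \<longleftrightarrow> continuous_on U f"
| "Ck_on (Suc k) U f \<longleftrightarrow> (\<forall>x\<in>U. f differentiable (at x)) \<and>
     (\<forall>b\<in>Basis. Ck_on k U (\<lambda>x. frechet_derivative f (at x) b))"

definition smooth_on :: "'a set \<Rightarrow> ('a::euclidean_space \<Rightarrow> real) \<Rightarrow> bool" where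
  "smooth_on U f \<longleftrightarrow> (\<forall>k. Ck_on k U f)"

lemma Ck_iff_Ck_on: "Ck k f \<longleftrightarrow> Ck_on k UNIV f"
  by (induction k arbitrary: f) auto

lemma Ck_on_cong:
  assumes "open U" "\<And>x. x \<in> U \<Longrightarrow> f x = g x" "Ck_on k U f"
  shows "Ck_on k U g"
  using assms(2,3)
proof (induction k arbitrary: f g)
  case 0
  then show ?case by (simp cong: continuous_on_cong)
next
  case (Suc k)
  have D: "(g has_derivative frechet_derivative f (at x)) (at x)" if "x \<in> U" for x
    using has_derivative_transform_within_open[of f _ x UNIV U g] Suc.prems assms(1) that
    by (simp flip: frechet_derivative_works)
  have eq: "frechet_derivative f (at x) b = frechet_derivative g (at x) b" if "x \<in> U" for x b
    using frechet_derivative_at[OF D[OF that]] by simp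
  have "Ck_on k U (\<lambda>x. frechet_derivative g (at x) b)" if "b \<in> Basis" for b
    by (rule Suc.IH[OF eq]) (use Suc.prems(2) that in simp_all)
  then show ?case using D by (auto simp: differentiable_def)
qed

lemma Ck_on_SucI:
  assumes "open U" "\<And>x. x \<in> U \<Longrightarrow> (f has_derivative D x) (at x)"
    "\<And>b. b \<in> Basis \<Longrightarrow> Ck_on k U (\<lambda>x. D x b)"
  shows "Ck_on (Suc k) U f"
proof -
  have "D x b = frechet_derivative f (at x) b" if "x \<in> U" for x b
    using frechet_derivative_at[OF assms(2)[OF that]] by simp
  then have "Ck_on k U (\<lambda>x. frechet_derivative f (at x) b)" if "b \<in> Basis" for b
    using that by (intro Ck_on_cong[OF assms(1) _ assms(3)]) auto
  then show ?thesis using assms(2) by (auto simp: differentiable_def)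
qed

lemma Ck_on_SucD:
  assumes "Ck_on (Suc k) U f" shows "Ck_on k U f"
  using assms
proof (induction k arbitrary: f)
  case 0
  then show ?case
    by (auto intro!: continuous_at_imp_continuous_on simp: differentiable_imp_continuous_within)
next
  case (Suc k)
  have "Ck_on k U (\<lambda>x. frechet_derivative f (at x) b)" if "b \<in> Basis" for b
    by (rule Suc.IH) (use Suc.prems that in simp)
  then show ?case using Suc.prems by simp
qed

lemma Ck_on_subset: "Ck_on k U f \<Longrightarrow> V \<subseteq> U \<Longrightarrow> Ck_on k V f"
  by (induction k arbitrary: f) (auto intro: continuous_on_subset)

lemma Ck_on_Un:
  assumes "open U" "open V" "Ck_on k U f" "Ck_on k V f"
  shows "Ck_on k (U \<union> V) f"
  using assms(3,4)
  by (induction k arbitrary: f) (auto intro: continuous_on_open_Un[OF assms(1,2)])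

lemma Ck_on_const: "Ck_on k U (\<lambda>x. c)"
  by (induction k arbitrary: c) auto

lemma Ck_on_add:
  assumes "open U" "Ck_on k U f" "Ck_on k U g"
  shows "Ck_on k U (\<lambda>x. f x + g x)"
  using assms(2,3)
proof (induction k arbitrary: f g)
  case 0 then show ?case by (simp add: continuous_on_add)
next
  case (Suc k)
  show ?case
  proof (rule Ck_on_SucI[OF assms(1), where D="\<lambda>x h. frechet_derivative f (at x) h + frechet_derivative g (at x) h"])
    show "((\<lambda>x. f x + g x) has_derivative (\<lambda>h. frechet_derivative f (at x) h + frechet_derivative g (at x) h)) (at x)"
      if "x \<in> U" for x
      using Suc.prems that by (intro has_derivative_add) (simp_all flip: frechet_derivative_works)
  qed (use Suc.prems Suc.IH in \<open>simp_all only: Ck_on.simps\<close>)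
qed

lemma Ck_on_mult:
  assumes "open U" "Ck_on k U f" "Ck_on k U g"
  shows "Ck_on k U (\<lambda>x. f x * g x)"
  using assms(2,3)
proof (induction k arbitrary: f g)
  case 0 then show ?case by (simp add: continuous_on_mult)
next
  case (Suc k)
  show ?case
  proof (rule Ck_on_SucI[OF assms(1), where D="\<lambda>x h. f x * frechet_derivative g (at x) h + frechet_derivative f (at x) h * g x"])
    show "((\<lambda>x. f x * g x) has_derivative (\<lambda>h. f x * frechet_derivative g (at x) h + frechet_derivative f (at x) h * g x)) (at x)"
      if "x \<in> U" for x
      using Suc.prems that by (intro has_derivative_mult) (simp_all flip: frechet_derivative_works)
    show "Ck_on k U (\<lambda>x. f x * frechet_derivative g (at x) b + frechet_derivative f (at x) b * g x)"
      if "b \<in> Basis" for b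
      using Suc.prems that Ck_on_SucD[of k U f] Ck_on_SucD[of k U g]
      by (intro Ck_on_add[OF assms(1)] Suc.IH) simp_all
  qed
qed

text \<open>
  The partial derivatives of \<open>g \<circ> f\<close> are products of those of \<open>f\<close> with \<open>g' \<circ> f\<close>, so the induction has
  to run over all outer functions \<open>g\<close> at once.
\<close>

lemma Ck_on_compose:
  fixes f :: "'a::euclidean_space \<Rightarrow> real" and g :: "real \<Rightarrow> real"
  assumes "open U" "open T" "Ck_on k T g" "Ck_on k U f" "\<And>x. x \<in> U \<Longrightarrow> f x \<in> T"
  shows "Ck_on k U (\<lambda>x. g (f x))"
  using assms(3,4)
proof (induction k arbitrary: g)
  case 0
  then show ?case
    using assms(5) continuous_on_compose2[of T g U f] by auto
next
  case (Suc k)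
  show ?case
  proof (rule Ck_on_SucI[OF assms(1), where D="\<lambda>x h. frechet_derivative f (at x) h * frechet_derivative g (at (f x)) 1"])
    fix x assume x: "x \<in> U"
    have f: "(f has_derivative frechet_derivative f (at x)) (at x)"
      and g: "(g has_derivative frechet_derivative g (at (f x))) (at (f x))"
      using Suc.prems x assms(5) by (simp_all flip: frechet_derivative_works)
    have lin: "frechet_derivative g (at (f x)) h = h * frechet_derivative g (at (f x)) 1" for h
      using linear_cmul[OF has_derivative_linear[OF g], of h 1] by simp
    show "((\<lambda>x. g (f x)) has_derivative (\<lambda>h. frechet_derivative f (at x) h * frechet_derivative g (at (f x)) 1)) (at x)"
      using has_derivative_compose[OF f g]
      by (subst lin[of "frechet_derivative f (at x) _", symmetric])
  next
    fix b :: 'a assume "b \<in> Basis"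
    then show "Ck_on k U (\<lambda>x. frechet_derivative f (at x) b * frechet_derivative g (at (f x)) 1)"
      using Suc.prems
      by (intro Ck_on_mult[OF assms(1)] Suc.IH[of "\<lambda>t. frechet_derivative g (at t) 1"] Ck_on_SucD[of k U f])
        simp_all
  qed
qed

lemma Ck_on_inner: "open U \<Longrightarrow> Ck_on k U (\<lambda>x. x \<bullet> c)"
proof (cases k)
  case (Suc n)
  assume "open U"
  then show ?thesis unfolding Suc
    by (intro Ck_on_SucI[where D="\<lambda>x h. h \<bullet> c"]) (auto intro!: Ck_on_const derivative_eq_intros)
qed (auto intro!: continuous_intros)

lemma Ck_on_powr: "Ck_on k {0<..} (\<lambda>t. t powr p)"
proof (induction k arbitrary: p)
  case (Suc k)
  show ?case
  proof (rule Ck_on_SucI[where D="\<lambda>t h. p * t powr (p - 1) * h"])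
    show "((\<lambda>t. t powr p) has_derivative (*) (p * t powr (p - 1))) (at t)" if "t \<in> {0<..}" for t
      using has_real_derivative_powr[of t p] that by (simp add: has_field_derivative_def)
  qed (auto intro!: Ck_on_mult Ck_on_const Suc)
qed (auto intro!: continuous_intros)

lemma Ck_on_DERIV:
  fixes f :: "real \<Rightarrow> real"
  assumes "open U" "\<And>t. t \<in> U \<Longrightarrow> (f has_real_derivative f' t) (at t)" "Ck_on k U f'"
  shows "Ck_on (Suc k) U f"
  by (rule Ck_on_SucI[OF assms(1), where D="\<lambda>t h. f' t * h"]) (use assms in \<open>auto simp: has_field_derivative_def\<close>)

lemma smooth_onI: "(\<And>k. Ck_on k U f) \<Longrightarrow> smooth_on U f"
  by (simp add: smooth_on_def)

lemma
  assumes "smooth_on U f"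
  shows smooth_on_imp_continuous_on: "continuous_on U f"
    and smooth_on_imp_differentiable: "x \<in> U \<Longrightarrow> f differentiable (at x)"
  using assms[unfolded smooth_on_def, rule_format, of 0] assms[unfolded smooth_on_def, rule_format, of 1] by auto

lemma smooth_on_cong: "open U \<Longrightarrow> (\<And>x. x \<in> U \<Longrightarrow> f x = g x) \<Longrightarrow> smooth_on U f \<Longrightarrow> smooth_on U g"
  unfolding smooth_on_def using Ck_on_cong by blast

lemma smooth_on_subset: "smooth_on U f \<Longrightarrow> V \<subseteq> U \<Longrightarrow> smooth_on V f"
  unfolding smooth_on_def using Ck_on_subset by blast

lemma smooth_on_Un: "open U \<Longrightarrow> open V \<Longrightarrow> smooth_on U f \<Longrightarrow> smooth_on V f \<Longrightarrow> smooth_on (U \<union> V) f"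
  unfolding smooth_on_def using Ck_on_Un by blast

lemma smooth_on_const: "smooth_on U (\<lambda>x. c)"
  by (simp add: smooth_on_def Ck_on_const)

lemma smooth_on_add: "open U \<Longrightarrow> smooth_on U f \<Longrightarrow> smooth_on U g \<Longrightarrow> smooth_on U (\<lambda>x. f x + g x)"
  by (simp add: smooth_on_def Ck_on_add)

lemma smooth_on_mult: "open U \<Longrightarrow> smooth_on U f \<Longrightarrow> smooth_on U g \<Longrightarrow> smooth_on U (\<lambda>x. f x * g x)"
  by (simp add: smooth_on_def Ck_on_mult)

lemma smooth_on_diff:
  assumes "open U" "smooth_on U f" "smooth_on U g" shows "smooth_on U (\<lambda>x. f x - g x)"
  using smooth_on_add[OF assms(1,2) smooth_on_mult[OF assms(1) smooth_on_const[of U "-1"] assms(3)]] by simp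

lemma smooth_on_compose:
  fixes f :: "'a::euclidean_space \<Rightarrow> real" and g :: "real \<Rightarrow> real"
  assumes "open U" "open T" "smooth_on T g" "smooth_on U f" "\<And>x. x \<in> U \<Longrightarrow> f x \<in> T"
  shows "smooth_on U (\<lambda>x. g (f x))"
  using assms unfolding smooth_on_def by (blast intro: Ck_on_compose)

lemma smooth_on_inner: "open U \<Longrightarrow> smooth_on U (\<lambda>x. x \<bullet> c)"
  by (simp add: smooth_on_def Ck_on_inner)

lemma smooth_on_powr: "smooth_on {0<..} (\<lambda>t. t powr p)"
  by (simp add: smooth_on_def Ck_on_powr)

lemma smooth_on_ln: "smooth_on {0<..} (ln :: real \<Rightarrow> real)"
proof (rule smooth_onI, rule Ck_on_SucD)
  show "Ck_on (Suc k) {0<..} (ln :: real \<Rightarrow> real)" for k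
    by (rule Ck_on_DERIV[OF _ _ Ck_on_powr[of k "-1"]])
      (auto intro!: derivative_eq_intros simp: powr_minus powr_one field_simps)
qed

text \<open>
  Off the origin, the norm is the square root of a positive polynomial in the coordinates.
\<close>

lemma smooth_on_norm: "smooth_on (-{0}) (norm :: 'a::euclidean_space \<Rightarrow> real)"
proof -
  have sum: "smooth_on (-{0}) (\<lambda>x::'a. \<Sum>b\<in>B. (x \<bullet> b) * (x \<bullet> b))" if "finite B" for B
    using that
    by (induction B) (auto intro!: smooth_on_add smooth_on_mult smooth_on_const smooth_on_inner)
  have eq: "(\<Sum>b\<in>Basis. (x \<bullet> b) * (x \<bullet> b)) = (norm x)\<^sup>2" for x :: 'a
    by (metis euclidean_inner power2_norm_eq_inner)
  have "smooth_on (-{0}) (\<lambda>x::'a. (\<Sum>b\<in>Basis. (x \<bullet> b) * (x \<bullet> b)) powr (1/2))"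
    by (rule smooth_on_compose[OF _ _ smooth_on_powr sum]) (auto simp: eq)
  then show ?thesis
    by (rule smooth_on_cong[rotated 2]) (auto simp: eq powr_half_sqrt)
qed

lemma smooth_on_norm_powr: "smooth_on (-{0}) (\<lambda>x::'a::euclidean_space. norm x powr p)"
  by (rule smooth_on_compose[OF _ _ smooth_on_powr smooth_on_norm]) auto

section \<open>A smooth step function\<close>

text \<open>
  The functions \<open>exp (-1/t) / t\<^sup>m\<close>, extended by \<open>0\<close> to \<open>t \<le> 0\<close>, form a family whose linear span is closed
  under differentiation, the origin included, since \<open>exp (-1/t)\<close> beats every power of \<open>1/t\<close> there.
  Hence all of them are smooth.
\<close>

lemma exp_bump_DERIV:
  fixes m :: nat
  defines "h \<equiv> \<lambda>m t. if t \<le> 0 then 0 else exp (- inverse t) * inverse t ^ m :: real"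
  shows "(h m has_real_derivative (h (m + 2) t - real m * h (Suc m) t)) (at t)"
proof -
  have lim: "((\<lambda>t. h n t) \<longlongrightarrow> 0) (at 0)" for n
  proof -
    have "((\<lambda>t::real. inverse t ^ n / exp (inverse t)) \<longlongrightarrow> 0) (at_right 0)"
      by (rule filterlim_compose[OF tendsto_power_div_exp_0 filterlim_inverse_at_top_right])
    then have R: "(h n \<longlongrightarrow> 0) (at_right 0)"
      by (rule Lim_transform_eventually)
        (rule eventually_mono[OF eventually_at_right_less], simp add: h_def exp_minus divide_inverse)
    have "(h n \<longlongrightarrow> 0) (at_left 0)"
      by (rule tendsto_eventually, rule eventually_mono[OF eventually_at_left_real[of "-1"]]) (auto simp: h_def)
    then show ?thesis using R by (simp add: filterlim_at_split)
  qed
  consider "t < 0" | "t = 0" | "t > 0" by linarith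
  then show ?thesis
  proof cases
    case 1
    have "((\<lambda>_. 0) has_real_derivative 0) (at t)" by simp
    then have "(h m has_real_derivative 0) (at t)"
      by (rule has_field_derivative_transform_within_open[where S="{..<0}"]) (use 1 in \<open>auto simp: h_def\<close>)
    then show ?thesis using 1 by (simp add: h_def)
  next
    case 2
    have "((\<lambda>y. (h m y - h m 0) / (y - 0)) \<longlongrightarrow> 0) (at 0)"
      by (rule Lim_transform_eventually[OF lim[of "Suc m"]]) (auto simp: h_def divide_inverse)
    then show ?thesis using 2 by (simp add: has_field_derivative_iff h_def)
  next
    case 3
    have "((\<lambda>t. exp (- inverse t) * inverse t ^ m) has_real_derivative
        exp (- inverse t) * inverse t ^ (m + 2) - real m * (exp (- inverse t) * inverse t ^ Suc m)) (at t)"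
      using 3 by - ((rule derivative_eq_intros | simp)+, cases m, simp_all add: field_simps power2_eq_square)
    then have "((\<lambda>t. exp (- inverse t) * inverse t ^ m) has_real_derivative
        h (m + 2) t - real m * h (Suc m) t) (at t)" using 3 by (simp add: h_def)
    then show ?thesis
      by (rule has_field_derivative_transform_within_open[where S="{0<..}"]) (use 3 in \<open>auto simp: h_def\<close>)
  qed
qed

lemma smooth_on_exp_bump: "smooth_on UNIV (\<lambda>t. if t \<le> 0 then 0 else exp (- inverse t) :: real)"
proof -
  define h where "h = (\<lambda>m t. if t \<le> 0 then 0 else exp (- inverse t) * inverse t ^ m :: real)"
  have D: "(h m has_real_derivative (h (m + 2) t - real m * h (Suc m) t)) (at t)" for m t
    unfolding h_def by (rule exp_bump_DERIV)
  have "Ck_on k UNIV (h m)" for k m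
  proof (induction k arbitrary: m)
    case 0
    then show ?case
      using DERIV_isCont[OF D] by (simp add: continuous_at_imp_continuous_on)
  next
    case (Suc k)
    have "Ck_on k UNIV (\<lambda>t. h (m + 2) t + (- real m) * h (Suc m) t)"
      by (intro Ck_on_add Ck_on_mult Ck_on_const Suc) auto
    then show ?case
      by (intro Ck_on_DERIV[where f'="\<lambda>t. h (m + 2) t - real m * h (Suc m) t"])
        (use D[of m] in simp_all)
  qed
  then have "smooth_on UNIV (h 0)" by (rule smooth_onI)
  then show ?thesis unfolding h_def power_0 mult_1_right .
qed

text \<open>
  With \<open>E t = exp (-1/t)\<close> for \<open>t > 0\<close> and \<open>E t = 0\<close> otherwise, the quotient
  \<open>E (2 - t) / (E (2 - t) + E (t - 1))\<close> descends smoothly from \<open>1\<close> to \<open>0\<close> between \<open>1\<close> and \<open>2\<close>: its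
  denominator never vanishes.
\<close>

lemma smooth_step_exists:
  obtains \<theta> \<theta>' :: "real \<Rightarrow> real" and B where "smooth_on UNIV \<theta>" "\<And>t. (\<theta> has_real_derivative \<theta>' t) (at t)"
    "\<And>t. t \<le> 1 \<Longrightarrow> \<theta> t = 1" "\<And>t. 2 \<le> t \<Longrightarrow> \<theta> t = 0" "\<And>t. 0 \<le> \<theta> t \<and> \<theta> t \<le> 1"
    "\<And>t. \<bar>\<theta>' t\<bar> \<le> B" "\<And>t. t \<notin> {1..2} \<Longrightarrow> \<theta>' t = 0"
proof -
  define E where "E = (\<lambda>t. if t \<le> 0 then 0 else exp (- inverse t) :: real)"
  define \<theta> where "\<theta> = (\<lambda>t. E (2 - t) * (E (2 - t) + E (t - 1)) powr (-1))"
  have E: "smooth_on UNIV E" unfolding E_def by (rule smooth_on_exp_bump)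
  have id: "smooth_on UNIV (\<lambda>t::real. t)"
    using smooth_on_inner[of UNIV "1::real"] by simp
  have E1: "smooth_on UNIV (\<lambda>t. E (2 - t))" and E2: "smooth_on UNIV (\<lambda>t. E (t - 1))"
    by (rule smooth_on_compose[OF _ _ E]; auto intro!: smooth_on_diff smooth_on_const id)+
  have pos: "E (2 - t) + E (t - 1) > 0" for t by (auto simp: E_def add_pos_pos)
  have sm: "smooth_on UNIV \<theta>" unfolding \<theta>_def
    by (intro smooth_on_mult E1 smooth_on_compose[OF _ _ smooth_on_powr] smooth_on_add E2)
      (auto simp: pos)
  have form: "\<theta> t = E (2 - t) / (E (2 - t) + E (t - 1))" for t
    using pos[of t] by (simp add: \<theta>_def powr_minus_divide)
  define \<theta>' where "\<theta>' = (\<lambda>t. frechet_derivative \<theta> (at t) 1)"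
  have d: "(\<theta> has_real_derivative \<theta>' t) (at t)" for t
  proof -
    have *: "(\<theta> has_derivative frechet_derivative \<theta> (at t)) (at t)"
      using smooth_on_imp_differentiable[OF sm, of t] by (simp flip: frechet_derivative_works)
    have "frechet_derivative \<theta> (at t) h = \<theta>' t * h" for h
      using linear_cmul[OF has_derivative_linear[OF *], of h 1] by (simp add: \<theta>'_def)
    then have "frechet_derivative \<theta> (at t) = (\<lambda>h. \<theta>' t * h)" by (rule ext)
    with * show ?thesis by (simp add: has_field_derivative_def)
  qed
  have c: "continuous_on UNIV \<theta>'"
    using sm[unfolded smooth_on_def, rule_format, of 1] by (simp add: \<theta>'_def)
  have one: "\<theta> t = 1" if "t \<le> 1" for t using that by (simp add: form E_def)
  have zero: "\<theta> t = 0" if "2 \<le> t" for t using that by (simp add: form E_def)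
  have out: "\<theta>' t = 0" if "t \<notin> {1..2}" for t
  proof -
    have "(\<theta> has_real_derivative 0) (at t)"
    proof (cases "t < 1")
      case True
      have "((\<lambda>_. 1) has_real_derivative 0) (at t)" by simp
      then show ?thesis
        by (rule has_field_derivative_transform_within_open[where S="{..<1}"]) (use True one in auto)
    next
      case False
      have "((\<lambda>_. 0) has_real_derivative 0) (at t)" by simp
      then show ?thesis
        by (rule has_field_derivative_transform_within_open[where S="{2<..}"]) (use False that zero in auto)
    qed
    then show ?thesis using d DERIV_unique by blast
  qed
  have "bounded (\<theta>' ` {1..2})"
    by (intro compact_imp_bounded compact_continuous_image continuous_on_subset[OF c]) auto
  then obtain B where B: "B > 0" "\<And>t. t \<in> {1..2} \<Longrightarrow> \<bar>\<theta>' t\<bar> \<le> B"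
    by (force simp: bounded_pos)
  have "\<bar>\<theta>' t\<bar> \<le> B" for t using B out by (cases "t \<in> {1..2}") auto
  moreover have "0 \<le> \<theta> t \<and> \<theta> t \<le> 1" for t using pos[of t] by (auto simp: form E_def)
  ultimately show thesis using that[of \<theta> \<theta>' B] sm d one zero out by blast
qed

section \<open>Integrals of powers of the norm\<close>

text \<open>
  The punctured unit ball is cut into the shells \<open>exp (-(j+1)) \<le> |x| \<le> exp (-j)\<close>. On the \<open>j\<close>-th shell
  \<open>|x| powr (-s)\<close> is at most \<open>exp (s * (j+1))\<close>, while the shell lies in a ball of volume proportional
  to \<open>exp (-j * N)\<close>, with \<open>N\<close> the dimension. Both integral estimates below sum these bounds.
\<close>

lemma exp_shell:
  fixes x :: "'a::euclidean_space"
  assumes "x \<noteq> 0" "norm x \<le> 1" "0 \<le> s"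
  defines "j \<equiv> nat \<lfloor>- ln (norm x)\<rfloor>"
  shows "norm x \<le> exp (- real j)" "norm x powr (- s) \<le> exp (s * (real j + 1))"
proof -
  have n: "- ln (norm x) \<ge> 0" using assms by simp
  have j: "real j \<le> - ln (norm x)" "- ln (norm x) \<le> real j + 1"
    using n unfolding j_def by linarith+
  have e: "norm x = exp (ln (norm x))" using assms by simp
  show "norm x \<le> exp (- real j)" by (subst e) (use j in simp)
  have "norm x powr (- s) = exp (s * (- ln (norm x)))" using assms by (simp add: powr_def)
  also have "\<dots> \<le> exp (s * (real j + 1))" using mult_left_mono[OF j(2) assms(3)] by simp
  finally show "norm x powr (- s) \<le> exp (s * (real j + 1))" .
qed

text \<open>
  For \<open>s < N\<close> the shell contributions form a convergent geometric series with ratio \<open>exp (s - N)\<close>.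
\<close>

lemma integrable_norm_powr_cball:
  assumes "0 \<le> s" "s < real DIM('a::euclidean_space)"
  shows "integrable lborel (\<lambda>x::'a. indicator (cball 0 R) x * norm x powr (- s))"
proof -
  let ?N = "real DIM('a)" and ?V = "unit_ball_vol (real DIM('a))"
  let ?h = "\<lambda>j (x::'a). ennreal (exp (s * (real j + 1))) * indicator (cball 0 (exp (- real j))) x"
  have term_le: "f j \<le> (\<Sum>j. f j)" for f :: "nat \<Rightarrow> ennreal" and j
    using sum_le_suminf[of f "{j}"] by simp
  have "(\<integral>\<^sup>+x. ennreal (indicator (cball (0::'a) 1) x * norm x powr (- s)) \<partial>lborel) \<le> (\<integral>\<^sup>+x. (\<Sum>j. ?h j x) \<partial>lborel)"
  proof (intro nn_integral_mono)
    fix x :: 'a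
    show "ennreal (indicator (cball 0 1) x * norm x powr (- s)) \<le> (\<Sum>j. ?h j x)"
    proof (cases "x \<noteq> 0 \<and> norm x \<le> 1")
      case True
      define j where "j = nat \<lfloor>- ln (norm x)\<rfloor>"
      have "ennreal (indicator (cball 0 1) x * norm x powr (- s)) \<le> ?h j x"
        using exp_shell[of x s] True assms(1) by (auto simp: j_def intro!: ennreal_leI)
      also have "\<dots> \<le> (\<Sum>j. ?h j x)"
        by (rule term_le)
      finally show ?thesis .
    next
      case False
      then have "indicator (cball 0 1) x * norm x powr (- s) = 0" by (auto simp: indicator_def)
      then show ?thesis by (simp only: ennreal_0 zero_le)
    qed
  qed
  also have "\<dots> = (\<Sum>j. \<integral>\<^sup>+x. ?h j x \<partial>lborel)"
    by (rule nn_integral_suminf) (intro borel_measurable_times_ennreal borel_measurable_indicator; simp)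
  also have "\<dots> = (\<Sum>j. ennreal (?V * exp s * exp (s - ?N) ^ j))"
  proof (rule suminf_cong)
    fix j
    have "(\<integral>\<^sup>+x. ?h j x \<partial>lborel) = ennreal (exp (s * (real j + 1))) * ennreal (?V * exp (- real j) ^ DIM('a))"
      by (subst nn_integral_cmult_indicator) (auto simp: emeasure_cball)
    also have "\<dots> = ennreal (exp (s * (real j + 1)) * (?V * exp (- real j) ^ DIM('a)))"
      by (rule ennreal_mult[symmetric]) (auto simp: unit_ball_vol_nonneg)
    also have "exp (s * (real j + 1)) * (?V * exp (- real j) ^ DIM('a)) = ?V * exp s * exp (s - ?N) ^ j"
      by (simp add: exp_of_nat_mult[symmetric] exp_add[symmetric] algebra_simps flip: exp_add)
    finally show "(\<integral>\<^sup>+x. ?h j x \<partial>lborel) = ennreal (?V * exp s * exp (s - ?N) ^ j)" .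
  qed
  also have "\<dots> < \<infinity>"
    using assms by (subst suminf_ennreal2) (auto intro!: summable_mult summable_geometric mult_nonneg_nonneg simp: unit_ball_vol_nonneg)
  finally have unit: "integrable lborel (\<lambda>x::'a. indicator (cball 0 1) x * norm x powr (- s))"
    by (intro integrableI_nonneg) (measurable, auto)
  have ball: "integrable lborel (\<lambda>x::'a. indicator (cball 0 R) x :: real)"
    by (rule integrable_real_indicator) (simp_all add: emeasure_bounded_finite[simplified])
  show ?thesis
  proof (rule Bochner_Integration.integrable_bound[OF Bochner_Integration.integrable_add[OF unit ball]])
    show "AE x::'a in lborel. norm (indicator (cball 0 R) x * norm x powr - s)
        \<le> norm (indicator (cball 0 1) x * norm x powr - s + indicator (cball 0 R) x)"
    proof (rule AE_I2)
      fix x :: 'a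
      have "norm x powr (- s) \<le> 1" if "norm x > 1"
        using powr_mono[of "- s" 0 "norm x"] that assms(1) by (simp split: if_splits)
      then show "norm (indicator (cball 0 R) x * norm x powr - s)
          \<le> norm (indicator (cball 0 1) x * norm x powr - s + indicator (cball 0 R) x)"
        by (auto simp: indicator_def not_le)
    qed
  qed (measurable, auto)
qed

text \<open>
  At the critical exponent \<open>s = N\<close> every shell contributes the same amount, and the annulus meets about
  \<open>k\<close> of them. This linear growth, against the factor \<open>1 / k\<^sup>2\<close> in the squared gradient of a logarithmic
  cutoff, is what makes the origin removable.
\<close>

lemma integral_norm_powr_annulus:
  defines "A \<equiv> \<lambda>k::nat. {x::'a::euclidean_space. exp (- (2 * real k)) \<le> norm x \<and> norm x \<le> exp (- real k)}"
  shows "integrable lborel (\<lambda>x. indicator (A k) x * norm x powr (- real DIM('a)))"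
    and "(\<integral>x. indicator (A k) x * norm x powr (- real DIM('a)) \<partial>lborel)
          \<le> unit_ball_vol (real DIM('a)) * exp (real DIM('a)) * (real k + 1)"
proof -
  let ?N = "real DIM('a)" and ?V = "unit_ball_vol (real DIM('a))"
  let ?h = "\<lambda>x::'a. \<Sum>j\<in>{k..2*k}. exp (?N * (real j + 1)) * indicator (cball 0 (exp (- real j))) x"
  have le: "indicator (A k) x * norm x powr (- ?N) \<le> ?h x" for x
  proof (cases "x \<in> A k")
    case True
    then have b: "exp (- (2 * real k)) \<le> norm x" "norm x \<le> exp (- real k)" by (auto simp: A_def)
    then have pos: "norm x > 0" by (meson exp_gt_zero less_le_trans)
    have "norm x \<le> 1" by (rule order_trans[OF b(2)]) simp
    moreover have "real k \<le> - ln (norm x)" "- ln (norm x) \<le> 2 * real k"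
      using ln_mono[OF b(1)] ln_mono[OF b(2) pos] by simp_all
    ultimately have x: "x \<noteq> 0" "norm x \<le> 1" "real k \<le> - ln (norm x)" "- ln (norm x) \<le> 2 * real k"
      using pos by auto
    define j where "j = nat \<lfloor>- ln (norm x)\<rfloor>"
    have j: "j \<in> {k..2*k}" using x(3,4) unfolding j_def by (auto simp: le_nat_floor nat_le_iff) linarith
    have "indicator (A k) x * norm x powr (- ?N) \<le> exp (?N * (real j + 1)) * indicator (cball 0 (exp (- real j))) x"
      using exp_shell[OF x(1,2), of ?N] True by (auto simp: j_def)
    also have "\<dots> \<le> ?h x" using j by (intro member_le_sum) auto
    finally show ?thesis .
  qed (auto intro!: sum_nonneg)
  have [measurable]: "A k \<in> sets borel" unfolding A_def by measurable
  have int: "integrable lborel ?h"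
    by (intro Bochner_Integration.integrable_sum integrable_mult_right) (auto simp: emeasure_cball)
  show 1: "integrable lborel (\<lambda>x. indicator (A k) x * norm x powr (- ?N))"
    by (rule Bochner_Integration.integrable_bound[OF int]) (auto intro!: AE_I2 order_trans[OF le])
  have "(\<integral>x. indicator (A k) x * norm x powr (- ?N) \<partial>lborel) \<le> (\<integral>x. ?h x \<partial>lborel)"
    by (rule integral_mono[OF 1 int le])
  also have "\<dots> = (\<Sum>j\<in>{k..2*k}. exp (?N * (real j + 1)) * (?V * exp (- real j) ^ DIM('a)))"
    by (subst Bochner_Integration.integral_sum) (auto simp: emeasure_cball content_cball)
  also have "\<dots> = (\<Sum>j\<in>{k..2*k}. ?V * exp ?N)"
    by (intro sum.cong refl) (simp add: exp_of_nat_mult[symmetric] algebra_simps flip: exp_add)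
  also have "\<dots> = ?V * exp ?N * (real k + 1)" by simp
  finally show "(\<integral>x. indicator (A k) x * norm x powr (- ?N) \<partial>lborel) \<le> ?V * exp ?N * (real k + 1)" .
qed

section \<open>Square integrable vector fields\<close>

lemma integrable_norm_add_power2:
  fixes f g :: "'a \<Rightarrow> 'b::{real_inner,banach,second_countable_topology}"
  assumes [measurable]: "f \<in> borel_measurable M" "g \<in> borel_measurable M"
    and "integrable M (\<lambda>x. (norm (f x))\<^sup>2)" "integrable M (\<lambda>x. (norm (g x))\<^sup>2)"
  shows "integrable M (\<lambda>x. (norm (f x + g x))\<^sup>2)"
proof (rule Bochner_Integration.integrable_bound)
  show "integrable M (\<lambda>x. 2 * (norm (f x))\<^sup>2 + 2 * (norm (g x))\<^sup>2)" using assms by simp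
  show "AE x in M. norm ((norm (f x + g x))\<^sup>2) \<le> norm (2 * (norm (f x))\<^sup>2 + 2 * (norm (g x))\<^sup>2)"
  proof (rule AE_I2)
    fix x
    have "(norm (f x + g x))\<^sup>2 \<le> (norm (f x) + norm (g x))\<^sup>2" by (intro power_mono norm_triangle_ineq) simp
    also have "\<dots> \<le> 2 * (norm (f x))\<^sup>2 + 2 * (norm (g x))\<^sup>2"
      using sum_squares_bound[of "norm (f x)" "norm (g x)"] by (simp add: power2_sum)
    finally show "norm ((norm (f x + g x))\<^sup>2) \<le> norm (2 * (norm (f x))\<^sup>2 + 2 * (norm (g x))\<^sup>2)" by simp
  qed
qed simp

text \<open>
  Minkowski's inequality, from Young's inequality with the weights \<open>q / p\<close> and \<open>p / q\<close>, where \<open>p\<close> and \<open>q\<close>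
  are slightly larger than the two norms so that they are positive.
\<close>

lemma L2_norm_triangle:
  fixes f g :: "'a \<Rightarrow> 'b::{real_inner,banach,second_countable_topology}"
  assumes [measurable]: "f \<in> borel_measurable M" "g \<in> borel_measurable M"
    and f: "integrable M (\<lambda>x. (norm (f x))\<^sup>2)" and g: "integrable M (\<lambda>x. (norm (g x))\<^sup>2)"
  shows "sqrt (\<integral>x. (norm (f x + g x))\<^sup>2 \<partial>M) \<le> sqrt (\<integral>x. (norm (f x))\<^sup>2 \<partial>M) + sqrt (\<integral>x. (norm (g x))\<^sup>2 \<partial>M)"
proof (rule field_le_epsilon)
  fix e :: real assume e: "e > 0"
  define p where "p = sqrt (\<integral>x. (norm (f x))\<^sup>2 \<partial>M) + e / 2"
  define q where "q = sqrt (\<integral>x. (norm (g x))\<^sup>2 \<partial>M) + e / 2"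
  have pq: "p > 0" "q > 0" using e by (auto simp: p_def q_def add_nonneg_pos)
  have fp: "(\<integral>x. (norm (f x))\<^sup>2 \<partial>M) \<le> p\<^sup>2" and gq: "(\<integral>x. (norm (g x))\<^sup>2 \<partial>M) \<le> q\<^sup>2"
    using e by (auto simp: p_def q_def intro!: sqrt_le_D)
  have young: "(norm (f x + g x))\<^sup>2 \<le> (1 + q / p) * (norm (f x))\<^sup>2 + (1 + p / q) * (norm (g x))\<^sup>2" for x
  proof -
    have "0 \<le> (q * norm (f x) - p * norm (g x))\<^sup>2 / (p * q)" using pq by simp
    also have "\<dots> = q / p * (norm (f x))\<^sup>2 + p / q * (norm (g x))\<^sup>2 - 2 * norm (f x) * norm (g x)"
      using pq by (simp add: field_simps power2_eq_square)
    finally have "(norm (f x) + norm (g x))\<^sup>2 \<le> (1 + q / p) * (norm (f x))\<^sup>2 + (1 + p / q) * (norm (g x))\<^sup>2"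
      by (simp add: power2_sum algebra_simps)
    moreover have "(norm (f x + g x))\<^sup>2 \<le> (norm (f x) + norm (g x))\<^sup>2" by (intro power_mono norm_triangle_ineq) simp
    ultimately show ?thesis by linarith
  qed
  have "(\<integral>x. (norm (f x + g x))\<^sup>2 \<partial>M) \<le> (\<integral>x. (1 + q / p) * (norm (f x))\<^sup>2 + (1 + p / q) * (norm (g x))\<^sup>2 \<partial>M)"
    using f g by (intro integral_mono integrable_norm_add_power2 young) auto
  also have "\<dots> = (1 + q / p) * (\<integral>x. (norm (f x))\<^sup>2 \<partial>M) + (1 + p / q) * (\<integral>x. (norm (g x))\<^sup>2 \<partial>M)"
    using f g by simp
  also have "\<dots> \<le> (1 + q / p) * p\<^sup>2 + (1 + p / q) * q\<^sup>2"
    using pq fp gq by (intro add_mono mult_left_mono) auto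
  also have "\<dots> = (p + q)\<^sup>2" using pq by (simp add: field_simps power2_eq_square)
  finally have "sqrt (\<integral>x. (norm (f x + g x))\<^sup>2 \<partial>M) \<le> p + q" using pq by (intro real_le_lsqrt) auto
  then show "sqrt (\<integral>x. (norm (f x + g x))\<^sup>2 \<partial>M)
      \<le> sqrt (\<integral>x. (norm (f x))\<^sup>2 \<partial>M) + sqrt (\<integral>x. (norm (g x))\<^sup>2 \<partial>M) + e"
    by (simp add: p_def q_def)
qed

section \<open>Dilations and the inverse square weight\<close>

lemma lborel_integral_scale:
  fixes f :: "'a::euclidean_space \<Rightarrow> real"
  assumes "f \<in> borel_measurable borel" "c > 0"
  shows "(\<integral>x. f x \<partial>lborel) = c ^ DIM('a) * (\<integral>x. f (c *\<^sub>R x) \<partial>lborel)"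
proof -
  have "(\<integral>x. f x \<partial>lborel) = (\<integral>x. f x \<partial>density (distr lborel borel (\<lambda>x. 0 + c *\<^sub>R x)) (\<lambda>_. ennreal (\<bar>c\<bar> ^ DIM('a))))"
    by (subst (1) lborel_affine[of c 0]) (use assms in auto)
  also have "\<dots> = (\<integral>x. c ^ DIM('a) * f x \<partial>distr lborel borel (\<lambda>x. 0 + c *\<^sub>R x))"
    using assms by (subst integral_density) auto
  also have "\<dots> = c ^ DIM('a) * (\<integral>x. f (c *\<^sub>R x) \<partial>lborel)"
    using assms by (subst integral_distr) auto
  finally show ?thesis .
qed

lemma integrable_bounded_by_norm_powr:
  fixes f :: "'a::euclidean_space \<Rightarrow> 'b::{banach,second_countable_topology}"
  assumes "f \<in> borel_measurable borel" "0 \<le> s" "s < real DIM('a)"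
    and "\<And>x. x \<noteq> 0 \<Longrightarrow> norm (f x) \<le> indicator (cball 0 R) x * (C * norm x powr (- s))"
  shows "integrable lborel f"
proof (rule Bochner_Integration.integrable_bound)
  show "integrable lborel (\<lambda>x::'a. C * (indicator (cball 0 R) x * norm x powr (- s)))"
    by (intro integrable_mult_right integrable_norm_powr_cball assms)
  show "AE x in lborel. norm (f x) \<le> norm (C * (indicator (cball 0 R) x * norm x powr (- s)))"
    using AE_lborel_singleton[of 0]
  proof eventually_elim
    case (elim x)
    then show ?case using assms(4)[of x] by (simp add: mult.left_commute)
  qed
qed (use assms in simp)

text \<open>
  By scaling, \<open>\<integral> g (t x) / |x|\<^sup>2 dx = t powr (2 - N) * \<integral> g x / |x|\<^sup>2 dx\<close>. Differentiating at \<open>t = 1\<close> gives the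
  identity, which is integration by parts against the vector field \<open>x / |x|\<^sup>2\<close> with divergence
  \<open>(N - 2) / |x|\<^sup>2\<close>, carried across the singularity.
\<close>

lemma integral_inverse_square_radial_derivative:
  fixes g :: "'a::euclidean_space \<Rightarrow> real" and D :: "'a \<Rightarrow> 'a"
  assumes N: "DIM('a) \<ge> 3"
    and D: "\<And>x. GDERIV g x :> D x" and contD: "continuous_on UNIV D"
    and supp: "\<And>x. norm x > R \<Longrightarrow> g x = 0"
  shows "integrable lborel (\<lambda>x. g x / (norm x)\<^sup>2)"
    and "integrable lborel (\<lambda>x. (D x \<bullet> x) / (norm x)\<^sup>2)"
    and "(\<integral>x. (D x \<bullet> x) / (norm x)\<^sup>2 \<partial>lborel) = (2 - real DIM('a)) * (\<integral>x. g x / (norm x)\<^sup>2 \<partial>lborel)"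
proof -
  have contg: "continuous_on UNIV g"
    using D by (auto simp: gderiv_def intro!: continuous_at_imp_continuous_on has_derivative_continuous)
  have suppD: "D x = 0" if "norm x > R" for x
  proof -
    have "((\<lambda>_. 0) has_derivative (\<lambda>_. 0)) (at x)" by simp
    then have "(g has_derivative (\<lambda>_. 0)) (at x)"
      by (rule has_derivative_transform_within_open[where s="- cball 0 R"]) (use that supp in auto)
    then have "(\<lambda>h. h \<bullet> D x) = (\<lambda>_. 0)" using D[of x] unfolding gderiv_def by (rule has_derivative_unique[rotated])
    then have "D x \<bullet> D x = 0" by meson
    then show ?thesis by simp
  qed
  have "bounded (D ` cball 0 R)"
    by (intro compact_imp_bounded compact_continuous_image continuous_on_subset[OF contD]) auto
  then obtain L where L: "L > 0" "\<And>x. x \<in> cball 0 R \<Longrightarrow> norm (D x) \<le> L" by (auto simp: bounded_pos)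
  have DL: "norm (D x) \<le> L" for x using L suppD[of x] by (cases "norm x \<le> R") auto
  have "bounded (g ` cball 0 R)"
    by (intro compact_imp_bounded compact_continuous_image continuous_on_subset[OF contg]) auto
  then obtain K where K: "K > 0" "\<And>x. x \<in> cball 0 R \<Longrightarrow> \<bar>g x\<bar> \<le> K" by (force simp: bounded_pos)
  have KR: "\<bar>g x\<bar> \<le> K" for x using K supp[of x] by (cases "norm x \<le> R") auto
  have lip: "\<bar>g x - g y\<bar> \<le> L * norm (x - y)" for x y
  proof -
    have "onorm (\<lambda>h. h \<bullet> D x) \<le> L" for x
    proof (rule onorm_bound)
      fix h show "norm (h \<bullet> D x) \<le> L * norm h"
        using Cauchy_Schwarz_ineq2[of h "D x"] mult_left_mono[OF DL[of x], of "norm h"] by (simp add: mult.commute)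
    qed (use L in simp)
    then have "norm (g x - g y) \<le> L * norm (x - y)"
      by (intro differentiable_bound[of UNIV g "\<lambda>x h. h \<bullet> D x"]) (use D in \<open>auto simp: gderiv_def\<close>)
    then show ?thesis by simp
  qed
  have [measurable]: "g \<in> borel_measurable borel" "D \<in> borel_measurable borel"
    using contg contD by (auto intro: borel_measurable_continuous_onI)
  show int_g: "integrable lborel (\<lambda>x. g x / (norm x)\<^sup>2)"
  proof (rule integrable_bounded_by_norm_powr[where s=2 and C=K and R=R])
    fix x :: 'a assume "x \<noteq> 0"
    then show "norm (g x / (norm x)\<^sup>2) \<le> indicator (cball 0 R) x * (K * norm x powr - 2)"
      using K(2)[of x] supp[of x] by (cases "norm x \<le> R") (auto simp: powr_minus_divide field_simps)
  qed (use N in auto)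
  show "integrable lborel (\<lambda>x. (D x \<bullet> x) / (norm x)\<^sup>2)"
  proof (rule integrable_bounded_by_norm_powr[where s=1 and C=L and R=R])
    fix x :: 'a assume x: "x \<noteq> 0"
    have "\<bar>D x \<bullet> x\<bar> \<le> L * norm x"
      using Cauchy_Schwarz_ineq2[of "D x" x] DL[of x] by (meson mult_right_mono norm_ge_zero order_trans)
    then show "norm ((D x \<bullet> x) / (norm x)\<^sup>2) \<le> indicator (cball 0 R) x * (L * norm x powr - 1)"
      using suppD[of x] x by (cases "norm x \<le> R") (auto simp: powr_minus_divide field_simps power2_eq_square)
  qed (use N in auto)
  define J where "J = (\<integral>x. g x / (norm x)\<^sup>2 \<partial>lborel)"
  \<comment> \<open>Dilations by factors larger than 1, so that \<open>g (t x)\<close> vanishes wherever \<open>|x| > R\<close>.\<close>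
  define t where "t n = 1 + inverse (real (Suc n))" for n
  have t: "t n > 1" for n by (simp add: t_def)
  have t_lim: "filterlim t (at 1) sequentially"
    unfolding filterlim_at t_def using LIMSEQ_inverse_real_of_nat_add[of 1] by auto
  define Q where "Q n x = (g (t n *\<^sub>R x) - g x) / (t n - 1) / (norm x)\<^sup>2" for n x
  have [measurable]: "Q n \<in> borel_measurable borel" for n unfolding Q_def by measurable
  have scale: "integrable lborel (\<lambda>x. g (t n *\<^sub>R x) / (norm x)\<^sup>2)"
    "(\<integral>x. g (t n *\<^sub>R x) / (norm x)\<^sup>2 \<partial>lborel) = t n powr (2 - real DIM('a)) * J" for n
  proof -
    have "g (t n *\<^sub>R x) = 0" if "norm x > R" for x
      using t[of n] that by (intro supp) (auto intro: less_le_trans[OF that] simp: mult_le_cancel_right1)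
    then show "integrable lborel (\<lambda>x. g (t n *\<^sub>R x) / (norm x)\<^sup>2)"
      by (intro integrable_bounded_by_norm_powr[where s=2 and C=K and R=R])
        (use N KR in \<open>auto simp: powr_minus_divide divide_right_mono indicator_def\<close>)
    have "J = t n ^ DIM('a) * (\<integral>x. g (t n *\<^sub>R x) / (norm (t n *\<^sub>R x))\<^sup>2 \<partial>lborel)"
      unfolding J_def by (rule lborel_integral_scale) (use t[of n] in auto)
    also have "(\<lambda>x. g (t n *\<^sub>R x) / (norm (t n *\<^sub>R x))\<^sup>2) = (\<lambda>x. inverse ((t n)\<^sup>2) * (g (t n *\<^sub>R x) / (norm x)\<^sup>2))"
      by (auto simp: power_mult_distrib divide_simps)
    finally have "J = t n ^ DIM('a) * inverse ((t n)\<^sup>2) * (\<integral>x. g (t n *\<^sub>R x) / (norm x)\<^sup>2 \<partial>lborel)"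
      by (simp only: integral_mult_right_zero mult.assoc)
    then show "(\<integral>x. g (t n *\<^sub>R x) / (norm x)\<^sup>2 \<partial>lborel) = t n powr (2 - real DIM('a)) * J"
      using t[of n] by (simp add: powr_diff powr_realpow divide_simps mult.commute)
  qed
  have intQ: "(\<integral>x. Q n x \<partial>lborel) = (t n powr (2 - real DIM('a)) - 1) / (t n - 1) * J" for n
  proof -
    have "Q n = (\<lambda>x. inverse (t n - 1) * (g (t n *\<^sub>R x) / (norm x)\<^sup>2 - g x / (norm x)\<^sup>2))"
      by (auto simp: Q_def fun_eq_iff divide_simps)
    then show ?thesis using scale[of n] int_g by (simp add: J_def field_simps)
  qed
  have "((\<lambda>r. r powr (2 - real DIM('a))) has_real_derivative (2 - real DIM('a))) (at 1)"
    by (auto intro!: derivative_eq_intros)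
  then have "((\<lambda>r. (r powr (2 - real DIM('a)) - 1) / (r - 1)) \<longlongrightarrow> 2 - real DIM('a)) (at 1)"
    by (simp add: has_field_derivative_iff)
  from tendsto_mult_right[OF filterlim_compose[OF this t_lim], of J]
  have lim1: "(\<lambda>n. \<integral>x. Q n x \<partial>lborel) \<longlonglongrightarrow> (2 - real DIM('a)) * J" by (simp add: intQ)
  have lim2: "(\<lambda>n. \<integral>x. Q n x \<partial>lborel) \<longlonglongrightarrow> (\<integral>x. (D x \<bullet> x) / (norm x)\<^sup>2 \<partial>lborel)"
  proof (rule integral_dominated_convergence)
    \<comment> \<open>The Lipschitz bound \<open>|g (t x) - g x| \<le> L (t - 1) |x|\<close> makes \<open>L / |x|\<close> a majorant of the difference quotients.\<close>
    show "integrable lborel (\<lambda>x::'a. L * (indicator (cball 0 R) x * norm x powr (- 1)))"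
      using N by (intro integrable_mult_right integrable_norm_powr_cball) auto
    show "AE x in lborel. norm (Q n x) \<le> L * (indicator (cball 0 R) x * norm x powr (- 1))" for n
    proof (rule AE_I2)
      fix x :: 'a
      show "norm (Q n x) \<le> L * (indicator (cball 0 R) x * norm x powr (- 1))"
      proof (cases "norm x > R")
        case True
        have "norm (t n *\<^sub>R x) > R"
          using t[of n] by (auto intro: less_le_trans[OF True] simp: mult_le_cancel_right1)
        then show ?thesis using True by (simp add: Q_def supp)
      next
        case False
        have "\<bar>g (t n *\<^sub>R x) - g x\<bar> \<le> L * ((t n - 1) * norm x)"
          using lip[of "t n *\<^sub>R x" x] t[of n] by (simp add: scaleR_left_diff_distrib[of _ 1, simplified, symmetric])
        then have "\<bar>g (t n *\<^sub>R x) - g x\<bar> / ((t n - 1) * (norm x)\<^sup>2)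
            \<le> L * ((t n - 1) * norm x) / ((t n - 1) * (norm x)\<^sup>2)"
          using t[of n] by (intro divide_right_mono) auto
        also have "\<dots> = L * norm x powr (- 1)"
          using t[of n] by (cases "x = 0") (auto simp: powr_minus_divide field_simps power2_eq_square)
        finally show ?thesis using False t[of n] by (simp add: Q_def abs_mult)
      qed
    qed
    show "AE x in lborel. (\<lambda>n. Q n x) \<longlonglongrightarrow> (D x \<bullet> x) / (norm x)\<^sup>2"
    proof (rule AE_I2)
      fix x
      have "((\<lambda>r. g (r *\<^sub>R x)) has_derivative (\<lambda>h. (h *\<^sub>R x) \<bullet> D x)) (at 1)"
      proof (rule has_derivative_compose[where f="\<lambda>r. r *\<^sub>R x" and g=g])
        show "((\<lambda>r. r *\<^sub>R x) has_derivative (\<lambda>h. h *\<^sub>R x)) (at 1)"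
          by (intro has_derivative_scaleR_left has_derivative_ident)
        show "(g has_derivative (\<lambda>h. h \<bullet> D x)) (at (1 *\<^sub>R x))"
          using D[of x] by (simp add: gderiv_def)
      qed
      then have "((\<lambda>r. g (r *\<^sub>R x)) has_real_derivative (D x \<bullet> x)) (at 1)"
        by (simp add: has_field_derivative_def inner_commute[of x] mult_commute_abs)
      then have "((\<lambda>r. (g (r *\<^sub>R x) - g x) / (r - 1)) \<longlongrightarrow> D x \<bullet> x) (at 1)"
        by (simp add: has_field_derivative_iff)
      from tendsto_mult_right[OF filterlim_compose[OF this t_lim], of "inverse ((norm x)\<^sup>2)"]
      show "(\<lambda>n. Q n x) \<longlonglongrightarrow> (D x \<bullet> x) / (norm x)\<^sup>2" by (simp add: Q_def divide_inverse)
    qed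
  qed auto
  show "(\<integral>x. (D x \<bullet> x) / (norm x)\<^sup>2 \<partial>lborel) = (2 - real DIM('a)) * (\<integral>x. g x / (norm x)\<^sup>2 \<partial>lborel)"
    using LIMSEQ_unique[OF lim2 lim1] by (simp add: J_def)
qed

section \<open>Completions and dense subsets\<close>

text \<open>
  Replacing each term of a Cauchy sequence by an approximant from \<open>Z\<close> whose error tends to \<open>0\<close>, both in
  \<open>q\<close> and in \<open>L\<^sup>2\<close>, changes neither the \<open>L\<^sup>2\<close> limit nor the limit of the norms.
\<close>

lemma completion_seq_approx:
  fixes q :: "('a::euclidean_space \<Rightarrow> real) \<Rightarrow> real"
  assumes diff: "\<And>u v. u \<in> P \<Longrightarrow> v \<in> P \<Longrightarrow> (\<lambda>x. u x - v x) \<in> P"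
    and tri: "\<And>u v. u \<in> P \<Longrightarrow> v \<in> P \<Longrightarrow> q (\<lambda>x. u x - v x) \<le> q u + q v"
    and sym: "\<And>u v. u \<in> P \<Longrightarrow> v \<in> P \<Longrightarrow> q (\<lambda>x. u x - v x) = q (\<lambda>x. v x - u x)"
    and L2: "P \<subseteq> L2_functions \<Omega>" and XP: "X \<subseteq> P" and ZP: "Z \<subseteq> P"
    and dense: "\<And>u e. u \<in> X \<Longrightarrow> 0 < e \<Longrightarrow>
        \<exists>w\<in>Z. q (\<lambda>x. u x - w x) < e \<and> (LINT x|lebesgue_on \<Omega>. (u x - w x)\<^sup>2) < e"
    and s: "completion_seq X q \<Omega> s u"
  obtains s' where "completion_seq Z q \<Omega> s' u" "(\<lambda>n. q (s n) - q (s' n)) \<longlonglongrightarrow> 0"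
proof -
  let ?e = "\<lambda>n. inverse (real (Suc n))"
  have sX: "s n \<in> X" for n using s by (simp add: completion_seq_def)
  have "\<forall>n. \<exists>w. w \<in> Z \<and> q (\<lambda>x. s n x - w x) < ?e n \<and> (LINT x|lebesgue_on \<Omega>. (s n x - w x)\<^sup>2) < ?e n"
    using dense[OF sX, of "?e n" for n] by auto
  then obtain s' where s': "\<And>n. s' n \<in> Z" "\<And>n. q (\<lambda>x. s n x - s' n x) < ?e n"
    "\<And>n. (LINT x|lebesgue_on \<Omega>. (s n x - s' n x)\<^sup>2) < ?e n" by metis
  have P: "s n \<in> P" "s' n \<in> P" for n using sX s'(1) XP ZP by auto
  have e0: "?e \<longlonglongrightarrow> 0" by (rule LIMSEQ_inverse_real_of_nat)
  have qs: "\<bar>q (s n) - q (s' n)\<bar> \<le> ?e n" for n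
  proof -
    have "q (s n) \<le> q (s' n) + q (\<lambda>x. s' n x - s n x)"
      using tri[OF P(2) diff[OF P(2) P(1)], of n n n] by simp
    moreover have "q (s' n) \<le> q (s n) + q (\<lambda>x. s n x - s' n x)"
      using tri[OF P(1) diff[OF P(1) P(2)], of n n n] by simp
    ultimately show ?thesis using sym[OF P, of n n] s'(2)[of n] by linarith
  qed
  have lim: "(\<lambda>n. q (s n) - q (s' n)) \<longlonglongrightarrow> 0"
    by (rule Lim_null_comparison[OF _ e0]) (use qs in auto)
  have cauchy: "\<exists>M. \<forall>m\<ge>M. \<forall>n\<ge>M. q (\<lambda>x. s' m x - s' n x) < e" if "e > 0" for e
  proof -
    have "e / 3 > 0" using that by simp
    then have "\<exists>M. \<forall>m\<ge>M. \<forall>n\<ge>M. q (\<lambda>x. s m x - s n x) < e / 3"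
      using s unfolding completion_seq_def by blast
    then obtain M1 where M1: "\<And>m n. m \<ge> M1 \<Longrightarrow> n \<ge> M1 \<Longrightarrow> q (\<lambda>x. s m x - s n x) < e / 3"
      by blast
    obtain M2 where M2: "\<And>n. n \<ge> M2 \<Longrightarrow> ?e n < e / 3"
      using order_tendstoD(2)[OF e0 \<open>e / 3 > 0\<close>] unfolding eventually_sequentially by blast
    have "q (\<lambda>x. s' m x - s' n x) < e" if "m \<ge> max M1 M2" "n \<ge> max M1 M2" for m n
    proof -
      have "q (\<lambda>x. s' m x - s' n x) \<le> q (\<lambda>x. s m x - s' n x) + q (\<lambda>x. s m x - s' m x)"
        using tri[OF diff[OF P(1) P(2)] diff[OF P(1) P(2)], of m n m m] by simp
      also have "q (\<lambda>x. s m x - s' n x) \<le> q (\<lambda>x. s m x - s n x) + q (\<lambda>x. s' n x - s n x)"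
        using tri[OF diff[OF P(1) P(1)] diff[OF P(2) P(1)], of m n n n] by simp
      finally show ?thesis
        using M1[of m n] M2[of m] M2[of n] s'(2)[of m] s'(2)[of n] sym[OF P, of n n] that by simp
    qed
    then show ?thesis by blast
  qed
  have u: "u \<in> L2_functions \<Omega>" and su: "(\<lambda>n. LINT x|lebesgue_on \<Omega>. (s n x - u x)\<^sup>2) \<longlonglongrightarrow> 0"
    using s by (auto simp: completion_seq_def)
  have L2diff: "integrable (lebesgue_on \<Omega>) (\<lambda>x. (v x - w x)\<^sup>2)"
    if "v \<in> L2_functions \<Omega>" "w \<in> L2_functions \<Omega>" for v w
    using that integrable_norm_add_power2[of v "lebesgue_on \<Omega>" "\<lambda>x. - w x"] by (simp add: L2_functions_def)
  have "(\<lambda>n. LINT x|lebesgue_on \<Omega>. (s' n x - u x)\<^sup>2) \<longlonglongrightarrow> 0"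
  proof (rule Lim_null_comparison)
    have "norm (LINT x|lebesgue_on \<Omega>. (s' n x - u x)\<^sup>2)
        \<le> 2 * ?e n + 2 * (LINT x|lebesgue_on \<Omega>. (s n x - u x)\<^sup>2)" for n
    proof -
      have i: "integrable (lebesgue_on \<Omega>) (\<lambda>x. (s' n x - u x)\<^sup>2)" "integrable (lebesgue_on \<Omega>) (\<lambda>x. (s n x - s' n x)\<^sup>2)"
        "integrable (lebesgue_on \<Omega>) (\<lambda>x. (s n x - u x)\<^sup>2)"
        using P[of n] L2 u by (auto intro!: L2diff)
      have "(LINT x|lebesgue_on \<Omega>. (s' n x - u x)\<^sup>2)
          \<le> (LINT x|lebesgue_on \<Omega>. 2 * (s n x - s' n x)\<^sup>2 + 2 * (s n x - u x)\<^sup>2)"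
      proof (rule integral_mono)
        fix x
        show "(s' n x - u x)\<^sup>2 \<le> 2 * (s n x - s' n x)\<^sup>2 + 2 * (s n x - u x)\<^sup>2"
          using zero_le_power2[of "(s n x - s' n x) + (s n x - u x)"] by (simp add: power2_eq_square algebra_simps)
      qed (use i in auto)
      also have "\<dots> = 2 * (LINT x|lebesgue_on \<Omega>. (s n x - s' n x)\<^sup>2) + 2 * (LINT x|lebesgue_on \<Omega>. (s n x - u x)\<^sup>2)"
        using i by simp
      finally show ?thesis using s'(3)[of n] by (simp add: integral_nonneg_AE)
    qed
    then show "\<forall>\<^sub>F n in sequentially. norm (LINT x|lebesgue_on \<Omega>. (s' n x - u x)\<^sup>2)
        \<le> 2 * ?e n + 2 * (LINT x|lebesgue_on \<Omega>. (s n x - u x)\<^sup>2)" by simp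
    show "(\<lambda>n. 2 * ?e n + 2 * (LINT x|lebesgue_on \<Omega>. (s n x - u x)\<^sup>2)) \<longlonglongrightarrow> 0"
      using tendsto_add[OF tendsto_mult_left[OF e0, of 2] tendsto_mult_left[OF su, of 2]] by simp
  qed
  with s'(1) cauchy u have "completion_seq Z q \<Omega> s' u" by (simp add: completion_seq_def)
  with lim that show thesis by blast
qed

text \<open>
  The sequences from \<open>X\<close> and those from \<open>Z\<close> reach the same limits \<open>u\<close> with the same limits of norms. Thus
  the conditions that single out the two norms of \<open>u\<close> are satisfied by the same numbers.
\<close>

lemma completion_dense_subset:
  fixes q :: "('a::euclidean_space \<Rightarrow> real) \<Rightarrow> real"
  assumes "\<And>u v. u \<in> P \<Longrightarrow> v \<in> P \<Longrightarrow> (\<lambda>x. u x - v x) \<in> P"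
    and "\<And>u v. u \<in> P \<Longrightarrow> v \<in> P \<Longrightarrow> q (\<lambda>x. u x - v x) \<le> q u + q v"
    and "\<And>u v. u \<in> P \<Longrightarrow> v \<in> P \<Longrightarrow> q (\<lambda>x. u x - v x) = q (\<lambda>x. v x - u x)"
    and "P \<subseteq> L2_functions \<Omega>" and XP: "X \<subseteq> P" and ZX: "Z \<subseteq> X"
    and "\<And>u e. u \<in> X \<Longrightarrow> 0 < e \<Longrightarrow>
        \<exists>w\<in>Z. q (\<lambda>x. u x - w x) < e \<and> (LINT x|lebesgue_on \<Omega>. (u x - w x)\<^sup>2) < e"
  shows "completion_space X q \<Omega> = completion_space Z q \<Omega>"
    and "completion_norm X q \<Omega> u = completion_norm Z q \<Omega> u"
proof -
  have sub: "completion_seq X q \<Omega> s u" if "completion_seq Z q \<Omega> s u" for s u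
    using that ZX by (auto simp: completion_seq_def)
  have approx: "\<exists>s'. completion_seq Z q \<Omega> s' u \<and> (\<lambda>n. q (s n) - q (s' n)) \<longlonglongrightarrow> 0" if "completion_seq X q \<Omega> s u" for s u
    using completion_seq_approx[OF assms(1-5) order_trans[OF ZX XP] assms(7) that] by blast
  show "completion_space X q \<Omega> = completion_space Z q \<Omega>"
    using sub approx by (auto simp: completion_space_def) blast
  have "(\<exists>s. completion_seq X q \<Omega> s u \<and> (\<lambda>n. q (s n)) \<longlonglongrightarrow> r)
      \<longleftrightarrow> (\<exists>s. completion_seq Z q \<Omega> s u \<and> (\<lambda>n. q (s n)) \<longlonglongrightarrow> r)" for r
  proof
    assume "\<exists>s. completion_seq X q \<Omega> s u \<and> (\<lambda>n. q (s n)) \<longlonglongrightarrow> r"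
    then obtain s where s: "completion_seq X q \<Omega> s u" "(\<lambda>n. q (s n)) \<longlonglongrightarrow> r" by blast
    then obtain s' where s': "completion_seq Z q \<Omega> s' u" "(\<lambda>n. q (s n) - q (s' n)) \<longlonglongrightarrow> 0"
      using approx by blast
    have "(\<lambda>n. q (s' n)) \<longlonglongrightarrow> r" using tendsto_diff[OF s(2) s'(2)] by simp
    with s' show "\<exists>s. completion_seq Z q \<Omega> s u \<and> (\<lambda>n. q (s n)) \<longlonglongrightarrow> r" by blast
  qed (use sub in blast)
  then show "completion_norm X q \<Omega> u = completion_norm Z q \<Omega> u" by (simp add: completion_norm_def)
qed

lemma completion_cong_norm:
  assumes "\<And>u v. u \<in> X \<Longrightarrow> v \<in> X \<Longrightarrow> (\<lambda>x. u x - v x) \<in> X" "\<And>u. u \<in> X \<Longrightarrow> q u = q' u"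
  shows "completion_space X q \<Omega> = completion_space X q' \<Omega>"
    and "completion_norm X q \<Omega> u = completion_norm X q' \<Omega> u"
proof -
  have seq: "completion_seq X q \<Omega> s u \<longleftrightarrow> completion_seq X q' \<Omega> s u" for s u
    using assms by (auto simp: completion_seq_def)
  have "(\<lambda>n. q (s n)) = (\<lambda>n. q' (s n))" if "completion_seq X q' \<Omega> s u" for s u
    using that assms(2) by (auto simp: completion_seq_def)
  then have "(completion_seq X q \<Omega> s u \<and> (\<lambda>n. q (s n)) \<longlonglongrightarrow> r)
      \<longleftrightarrow> (completion_seq X q' \<Omega> s u \<and> (\<lambda>n. q' (s n)) \<longlonglongrightarrow> r)" for s r
    using seq by (metis (no_types, lifting))
  then show "completion_norm X q \<Omega> u = completion_norm X q' \<Omega> u" by (simp add: completion_norm_def)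
  show "completion_space X q \<Omega> = completion_space X q' \<Omega>" by (simp add: completion_space_def seq)
qed

section \<open>Gradients and test functions\<close>

lemma grad_eqI:
  assumes "GDERIV f x :> D" shows "grad f x = D"
proof -
  have "frechet_derivative f (at x) = (\<lambda>h. h \<bullet> D)"
    using frechet_derivative_at assms unfolding gderiv_def by metis
  then show ?thesis by (simp add: grad_def inner_commute[of _ D] euclidean_representation)
qed

lemma GDERIV_grad:
  fixes f :: "'a::euclidean_space \<Rightarrow> real"
  assumes "f differentiable (at x)" shows "GDERIV f x :> grad f x"
proof -
  have d: "(f has_derivative frechet_derivative f (at x)) (at x)"
    using assms by (simp flip: frechet_derivative_works)
  have "frechet_derivative f (at x) h = h \<bullet> grad f x" for h
  proof -
    have "frechet_derivative f (at x) h = frechet_derivative f (at x) (\<Sum>b\<in>Basis. (h \<bullet> b) *\<^sub>R b)"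
      by (simp add: euclidean_representation)
    also have "\<dots> = (\<Sum>b\<in>Basis. (h \<bullet> b) * frechet_derivative f (at x) b)"
      using has_derivative_linear[OF d] by (simp add: linear_sum linear_cmul)
    also have "\<dots> = h \<bullet> grad f x" by (simp add: grad_def inner_sum_right mult.commute)
    finally show ?thesis .
  qed
  then have "frechet_derivative f (at x) = (\<lambda>h. h \<bullet> grad f x)" by (rule ext)
  with d show ?thesis by (simp add: gderiv_def)
qed

lemma GDERIV_transform_within_open:
  assumes "GDERIV f x :> D" "open S" "x \<in> S" "\<And>y. y \<in> S \<Longrightarrow> f y = g y"
  shows "GDERIV g x :> D"
  using has_derivative_transform_within_open[of f "\<lambda>h. h \<bullet> D" x UNIV S g] assms by (simp add: gderiv_def)

lemma grad_eq_0:
  assumes "x \<notin> closure {y. f y \<noteq> 0}"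
  shows "grad f x = 0"
  by (rule grad_eqI, rule GDERIV_transform_within_open[OF GDERIV_const[of 0], of "- closure {y. f y \<noteq> 0}"])
    (use assms closure_subset[of "{y. f y \<noteq> 0}"] in auto)

lemma smooth_on_imp_continuous_on_grad:
  assumes "smooth_on U f" shows "continuous_on U (grad f)"
  using assms[unfolded smooth_on_def, rule_format, of 1]
  unfolding grad_def by (auto intro!: continuous_on_sum continuous_on_scaleR)

lemma test_functions_iff:
  "\<phi> \<in> test_functions \<Omega> \<longleftrightarrow>
    smooth_on UNIV \<phi> \<and> compact (closure {x. \<phi> x \<noteq> 0}) \<and> closure {x. \<phi> x \<noteq> 0} \<subseteq> \<Omega>"
  by (auto simp: test_functions_def smooth_on_def Ck_iff_Ck_on)

lemma support_diff:
  fixes u v :: "'a::euclidean_space \<Rightarrow> real"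
  assumes "compact (closure {x. u x \<noteq> 0})" "closure {x. u x \<noteq> 0} \<subseteq> \<Omega>"
    "compact (closure {x. v x \<noteq> 0})" "closure {x. v x \<noteq> 0} \<subseteq> \<Omega>"
  shows "compact (closure {x. u x - v x \<noteq> 0})" "closure {x. u x - v x \<noteq> 0} \<subseteq> \<Omega>"
proof -
  have sub: "closure {x. u x - v x \<noteq> 0} \<subseteq> closure {x. u x \<noteq> 0} \<union> closure {x. v x \<noteq> 0}"
    unfolding closure_Un[symmetric] by (rule closure_mono) auto
  show "closure {x. u x - v x \<noteq> 0} \<subseteq> \<Omega>" using sub assms by blast
  have "bounded (closure {x. u x - v x \<noteq> 0})"
    by (rule bounded_subset[OF _ sub]) (intro bounded_Un[THEN iffD2] conjI compact_imp_bounded assms)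
  then show "compact (closure {x. u x - v x \<noteq> 0})" by (simp add: compact_eq_bounded_closed)
qed

lemma support_mono:
  fixes u v :: "'a::euclidean_space \<Rightarrow> real"
  assumes "compact (closure {x. v x \<noteq> 0})" "closure {x. v x \<noteq> 0} \<subseteq> \<Omega>" "\<And>x. v x = 0 \<Longrightarrow> u x = 0"
  shows "compact (closure {x. u x \<noteq> 0})" "closure {x. u x \<noteq> 0} \<subseteq> \<Omega>"
proof -
  have sub: "closure {x. u x \<noteq> 0} \<subseteq> closure {x. v x \<noteq> 0}" using assms(3) by (intro closure_mono) auto
  show "closure {x. u x \<noteq> 0} \<subseteq> \<Omega>" using sub assms by blast
  have "bounded (closure {x. u x \<noteq> 0})"
    using bounded_subset[OF _ sub] assms compact_imp_bounded by blast
  then show "compact (closure {x. u x \<noteq> 0})" by (simp add: compact_eq_bounded_closed)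
qed

lemma test_functions_diff:
  assumes "u \<in> test_functions \<Omega>" "v \<in> test_functions \<Omega>"
  shows "(\<lambda>x. u x - v x) \<in> test_functions \<Omega>"
  using assms support_diff[of u \<Omega> v] by (auto simp: test_functions_iff intro: smooth_on_diff)

lemma test_function_bounds:
  fixes \<phi> :: "'a::euclidean_space \<Rightarrow> real"
  assumes "\<phi> \<in> test_functions \<Omega>"
  obtains B R where "B > 0" "R \<ge> 1" "\<And>x. \<bar>\<phi> x\<bar> \<le> B" "\<And>x. norm (grad \<phi> x) \<le> B"
    "\<And>x. x \<in> closure {x. \<phi> x \<noteq> 0} \<Longrightarrow> norm x \<le> R"
proof -
  let ?K = "closure {x. \<phi> x \<noteq> 0}"
  have sm: "smooth_on UNIV \<phi>" and K: "compact ?K" using assms by (auto simp: test_functions_iff)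
  have "bounded (\<phi> ` ?K)" "bounded (grad \<phi> ` ?K)"
    by (auto intro!: compact_imp_bounded compact_continuous_image K
      continuous_on_subset[OF smooth_on_imp_continuous_on[OF sm]]
      continuous_on_subset[OF smooth_on_imp_continuous_on_grad[OF sm]])
  then obtain B1 B2 where B1: "B1 > 0" "\<And>x. x \<in> ?K \<Longrightarrow> \<bar>\<phi> x\<bar> \<le> B1"
    and B2: "B2 > 0" "\<And>x. x \<in> ?K \<Longrightarrow> norm (grad \<phi> x) \<le> B2"
    by (auto simp: bounded_pos)
  obtain R where R: "\<And>x. x \<in> ?K \<Longrightarrow> norm x \<le> R"
    using compact_imp_bounded[OF K] by (auto simp: bounded_iff)
  have "\<bar>\<phi> x\<bar> \<le> B1 + B2" for x
    using B1 B2(1) closure_subset[of "{x. \<phi> x \<noteq> 0}"] by (cases "\<phi> x = 0") (auto intro: order_trans[OF B1(2)])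
  moreover have "norm (grad \<phi> x) \<le> B1 + B2" for x
    using B1(1) B2 grad_eq_0[of x \<phi>] by (cases "x \<in> ?K") (auto intro: order_trans[OF B2(2)])
  moreover have "norm x \<le> max 1 R" if "x \<in> ?K" for x using R[OF that] by simp
  ultimately show thesis using that[of "B1 + B2" "max 1 R"] B1(1) B2(1) by simp
qed

section \<open>The weighted gradient and a class containing both cores\<close>

text \<open>
  The vector field whose squared \<open>L\<^sup>2\<close> norm is the square of \<open>calH_prenorm\<close>, so that properties of that
  prenorm reduce to properties of the \<open>L\<^sup>2\<close> norm of a linear expression in \<open>u\<close>.
\<close>

definition weighted_grad :: "('a::euclidean_space \<Rightarrow> real) \<Rightarrow> 'a \<Rightarrow> 'a" where
  "weighted_grad u x = norm x powr (- ((real DIM('a) - 2) / 2)) *\<^sub>R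
     grad (\<lambda>y. norm y powr ((real DIM('a) - 2) / 2) * u y) x"

lemma weighted_grad_0 [simp]: "weighted_grad u 0 = 0"
  by (simp add: weighted_grad_def)

text \<open>
  At the origin both sides vanish because \<open>0 powr p = 0\<close>.
\<close>

lemma norm_weighted_grad:
  "norm x powr (- (real DIM('a) - 2)) * (norm (grad (\<lambda>y. norm y powr ((real DIM('a) - 2) / 2) * u y) x))\<^sup>2
    = (norm (weighted_grad u (x::'a::euclidean_space)))\<^sup>2"
proof -
  have "(norm x powr (- ((real DIM('a) - 2) / 2)))\<^sup>2 = norm x powr (- (real DIM('a) - 2))"
    by (simp add: power2_eq_square powr_add[symmetric] diff_divide_distrib)
  then show ?thesis by (simp add: weighted_grad_def power_mult_distrib)
qed

lemma weighted_grad_eq: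
  fixes u :: "'a::euclidean_space \<Rightarrow> real"
  assumes "x \<noteq> 0" "u differentiable (at x)"
  shows "weighted_grad u x = grad u x + ((real DIM('a) - 2) / 2 * u x / (norm x)\<^sup>2) *\<^sub>R x"
proof -
  define a where "a = (real DIM('a) - 2) / 2"
  have "((\<lambda>r. r powr a) has_real_derivative a * norm x powr (a - 1)) (at (norm x))"
    using has_real_derivative_powr[of "norm x" a] assms(1) by simp
  from GDERIV_DERIV_compose[OF GDERIV_norm[OF assms(1)] this]
  have "GDERIV (\<lambda>y. norm y powr a) x :> (a * norm x powr (a - 1)) *\<^sub>R sgn x" .
  from GDERIV_mult[OF this GDERIV_grad[OF assms(2)]]
  have "grad (\<lambda>y. norm y powr a * u y) x
      = norm x powr a *\<^sub>R grad u x + u x *\<^sub>R (a * norm x powr (a - 1)) *\<^sub>R sgn x"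
    by (rule grad_eqI)
  then have "weighted_grad u x = (norm x powr (- a) * norm x powr a) *\<^sub>R grad u x
      + (a * u x * (norm x powr (- a) * norm x powr (a - 1))) *\<^sub>R sgn x"
    by (simp add: weighted_grad_def a_def[symmetric] scaleR_add_right mult_ac)
  also have "norm x powr (- a) * norm x powr a = 1" using assms(1) by (simp flip: powr_add)
  also have "norm x powr (- a) * norm x powr (a - 1) = inverse (norm x)"
    using assms(1) by (simp add: powr_add[symmetric] powr_neg_one inverse_eq_divide)
  finally show ?thesis
    unfolding a_def[symmetric] by (simp add: sgn_div_norm power2_eq_square inverse_eq_divide)
qed

lemma weighted_grad_diff:
  assumes "u differentiable (at x)" "v differentiable (at x)"
  shows "weighted_grad (\<lambda>y. u y - v y) x = weighted_grad u x - weighted_grad v x"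
proof (cases "x = 0")
  case False
  have "grad (\<lambda>y. u y - v y) x = grad u x - grad v x"
    by (intro grad_eqI GDERIV_diff GDERIV_grad assms)
  then show ?thesis
    using weighted_grad_eq[OF False assms(1)] weighted_grad_eq[OF False assms(2)]
      weighted_grad_eq[OF False differentiable_diff[OF assms]]
    by (simp add: right_diff_distrib diff_divide_distrib scaleR_left_diff_distrib)
qed simp

text \<open>
  A vector space containing the test functions as well as the functions \<open>|x| powr (-a) * v\<close> with \<open>v\<close> a test
  function, where \<open>a = (N - 2) / 2\<close>. The pointwise bound is the singularity of the latter, and it is
  what makes the error of a logarithmic cutoff tend to \<open>0\<close>. The value at the origin is left
  unconstrained, since a single point does not affect the integrals.
\<close>

definition hardy_class :: "'a::euclidean_space set \<Rightarrow> ('a \<Rightarrow> real) set" where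
  "hardy_class \<Omega> = {u. smooth_on (- {0}) u \<and> compact (closure {x. u x \<noteq> 0}) \<and> closure {x. u x \<noteq> 0} \<subseteq> \<Omega> \<and>
     (\<exists>C. \<forall>x. x \<noteq> 0 \<longrightarrow> \<bar>u x\<bar> \<le> C * norm x powr (- ((real DIM('a) - 2) / 2))) \<and>
     integrable lborel (\<lambda>x. (norm (weighted_grad u x))\<^sup>2)}"

lemma hardy_class_differentiable: "u \<in> hardy_class \<Omega> \<Longrightarrow> x \<noteq> 0 \<Longrightarrow> u differentiable (at x)"
  by (auto simp: hardy_class_def intro: smooth_on_imp_differentiable)

lemma smooth_off_0_measurable:
  assumes "smooth_on (- {0}) u"
  shows "u \<in> borel_measurable borel" "weighted_grad u \<in> borel_measurable borel"
proof -
  note c = smooth_on_imp_continuous_on[OF assms]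
  show "u \<in> borel_measurable borel"
    by (rule borel_measurable_continuous_countable_exceptions[OF _ c]) simp
  have "continuous_on (- {0}) (weighted_grad u) \<longleftrightarrow> continuous_on (- {0})
      (\<lambda>x. grad u x + ((real DIM('a) - 2) / 2 * u x / (norm x)\<^sup>2) *\<^sub>R x)"
    by (rule continuous_on_cong[OF refl]) (use smooth_on_imp_differentiable[OF assms] in \<open>auto simp: weighted_grad_eq\<close>)
  also have "\<dots>"
    by (intro continuous_intros c smooth_on_imp_continuous_on_grad[OF assms]) auto
  finally show "weighted_grad u \<in> borel_measurable borel"
    by (intro borel_measurable_continuous_countable_exceptions[of "{0}"]) simp_all
qed

lemma hardy_class_measurable:
  assumes "u \<in> hardy_class \<Omega>"
  shows "u \<in> borel_measurable borel" "weighted_grad u \<in> borel_measurable borel"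
  using assms smooth_off_0_measurable by (auto simp: hardy_class_def)

lemma integral_lebesgue_on_eq_lborel:
  fixes f :: "'a::euclidean_space \<Rightarrow> real"
  assumes "\<Omega> \<in> sets borel" "f \<in> borel_measurable borel" "\<And>x. x \<notin> \<Omega> \<Longrightarrow> f x = 0"
  shows "integrable (lebesgue_on \<Omega>) f \<longleftrightarrow> integrable lborel f"
    and "(LINT x|lebesgue_on \<Omega>. f x) = (LINT x|lborel. f x)"
proof -
  have e: "(\<lambda>x. indicator \<Omega> x *\<^sub>R f x) = f" using assms(3) by (auto simp: indicator_def fun_eq_iff)
  have m: "\<Omega> \<inter> space lebesgue \<in> sets lebesgue" using assms(1) by auto
  show "integrable (lebesgue_on \<Omega>) f \<longleftrightarrow> integrable lborel f"
    unfolding integrable_restrict_space[OF m] e using assms(2) by (simp add: integrable_completion)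
  show "(LINT x|lebesgue_on \<Omega>. f x) = (LINT x|lborel. f x)"
    unfolding integral_restrict_space[OF m] e using assms(2) by (simp add: integral_completion)
qed

lemma weighted_grad_eq_0:
  assumes "x \<notin> closure {y. u y \<noteq> 0}"
  shows "weighted_grad u x = 0"
proof -
  have "closure {y. norm y powr ((real DIM('a) - 2) / 2) * u y \<noteq> 0} \<subseteq> closure {y::'a. u y \<noteq> 0}"
    by (rule closure_mono) auto
  then show ?thesis using assms by (auto simp: weighted_grad_def intro!: grad_eq_0)
qed

lemma hardy_class_vanish:
  assumes "u \<in> hardy_class \<Omega>" "x \<notin> \<Omega>"
  shows "u x = 0" "weighted_grad u x = 0"
proof -
  have "x \<notin> closure {y. u y \<noteq> 0}" using assms by (auto simp: hardy_class_def)
  then show "u x = 0" "weighted_grad u x = 0"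
    using closure_subset[of "{y. u y \<noteq> 0}"] weighted_grad_eq_0 by auto
qed

text \<open>
  The square of the pointwise bound is \<open>|x| powr (-(N - 2))\<close>, which is locally integrable.
\<close>

lemma hardy_class_integrable_power2:
  fixes u :: "'a::euclidean_space \<Rightarrow> real"
  assumes "u \<in> hardy_class \<Omega>" "DIM('a) \<ge> 3"
  shows "integrable lborel (\<lambda>x. (u x)\<^sup>2)"
proof -
  obtain C where C: "\<And>x. x \<noteq> 0 \<Longrightarrow> \<bar>u x\<bar> \<le> C * norm x powr (- ((real DIM('a) - 2) / 2))"
    using assms(1) by (auto simp: hardy_class_def)
  have "bounded (closure {x. u x \<noteq> 0})" using assms(1) by (auto simp: hardy_class_def compact_imp_bounded)
  then obtain R where R: "\<And>x. u x \<noteq> 0 \<Longrightarrow> norm x \<le> R"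
    using closure_subset[of "{y. u y \<noteq> 0}"] by (force simp: bounded_iff)
  have [measurable]: "u \<in> borel_measurable borel" by (rule hardy_class_measurable[OF assms(1)])
  show ?thesis
  proof (rule integrable_bounded_by_norm_powr[where s="real DIM('a) - 2" and C="C\<^sup>2" and R=R])
    fix x :: 'a assume x: "x \<noteq> 0"
    have "(norm x powr (- ((real DIM('a) - 2) / 2)))\<^sup>2 = norm x powr (- (real DIM('a) - 2))"
      by (simp add: power2_eq_square powr_add[symmetric] diff_divide_distrib)
    then have "(u x)\<^sup>2 \<le> C\<^sup>2 * norm x powr (- (real DIM('a) - 2))"
      using power_mono[OF C[OF x], of 2] by (simp add: power_mult_distrib)
    then show "norm ((u x)\<^sup>2) \<le> indicator (cball 0 R) x * (C\<^sup>2 * norm x powr (- (real DIM('a) - 2)))"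
      using R[of x] by (cases "u x = 0") auto
  qed (use assms in auto)
qed

lemma hardy_class_L2:
  fixes \<Omega> :: "'a::euclidean_space set"
  assumes "DIM('a) \<ge> 3" "\<Omega> \<in> sets borel"
  shows "hardy_class \<Omega> \<subseteq> L2_functions \<Omega>"
proof
  fix u assume u: "u \<in> hardy_class \<Omega>"
  have [measurable]: "u \<in> borel_measurable borel" by (rule hardy_class_measurable[OF u])
  have "u \<in> borel_measurable (lebesgue_on \<Omega>)"
    by (rule measurable_restrict_space1) (simp add: measurable_completion)
  then show "u \<in> L2_functions \<Omega>"
    using hardy_class_integrable_power2[OF u assms(1)] hardy_class_vanish(1)[OF u]
      integral_lebesgue_on_eq_lborel(1)[OF assms(2), of "\<lambda>x. (u x)\<^sup>2"]
    by (simp add: L2_functions_def)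
qed

lemma hardy_class_diff:
  assumes u: "u \<in> hardy_class \<Omega>" and v: "v \<in> hardy_class \<Omega>"
  shows "(\<lambda>x. u x - v x) \<in> hardy_class \<Omega>"
proof -
  let ?w = "\<lambda>x::'a. norm x powr (- ((real DIM('a) - 2) / 2))"
  obtain C1 C2 where C: "\<And>x. x \<noteq> 0 \<Longrightarrow> \<bar>u x\<bar> \<le> C1 * ?w x" "\<And>x. x \<noteq> 0 \<Longrightarrow> \<bar>v x\<bar> \<le> C2 * ?w x"
    using u v by (auto simp: hardy_class_def)
  have "\<bar>u x - v x\<bar> \<le> (C1 + C2) * ?w x" if "x \<noteq> 0" for x
    using C[OF that] abs_triangle_ineq4[of "u x" "v x"] by (simp add: distrib_right)
  moreover have "integrable lborel (\<lambda>x. (norm (weighted_grad (\<lambda>x. u x - v x) x))\<^sup>2)"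
  proof -
    have "integrable lborel (\<lambda>x. (norm (weighted_grad u x + - weighted_grad v x))\<^sup>2)"
      using u v hardy_class_measurable[OF u] hardy_class_measurable[OF v]
      by (intro integrable_norm_add_power2) (auto simp: hardy_class_def)
    also have "(\<lambda>x. weighted_grad u x + - weighted_grad v x) = weighted_grad (\<lambda>x. u x - v x)"
    proof
      fix x show "weighted_grad u x + - weighted_grad v x = weighted_grad (\<lambda>x. u x - v x) x"
        using weighted_grad_diff[of u x v] u v by (cases "x = 0") (auto simp: hardy_class_differentiable)
    qed
    finally show ?thesis .
  qed
  ultimately show ?thesis
    using u v support_diff[of u \<Omega> v] by (auto simp: hardy_class_def intro!: smooth_on_diff)
qed

lemma calH_prenorm_hardy_class:
  assumes u: "u \<in> hardy_class \<Omega>" and "\<Omega> \<in> sets borel"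
  shows "calH_prenorm \<Omega> u = sqrt (\<integral>x. (norm (weighted_grad u x))\<^sup>2 \<partial>lborel)"
  unfolding calH_prenorm_def norm_weighted_grad
  using hardy_class_measurable(2)[OF u] hardy_class_vanish(2)[OF u] assms(2)
  by (subst integral_lebesgue_on_eq_lborel(2)) auto

lemma calH_prenorm_diff:
  assumes u: "u \<in> hardy_class \<Omega>" and v: "v \<in> hardy_class \<Omega>" and \<Omega>: "\<Omega> \<in> sets borel"
  shows "calH_prenorm \<Omega> (\<lambda>x. u x - v x) \<le> calH_prenorm \<Omega> u + calH_prenorm \<Omega> v"
    and "calH_prenorm \<Omega> (\<lambda>x. u x - v x) = calH_prenorm \<Omega> (\<lambda>x. v x - u x)"
proof -
  have e: "weighted_grad (\<lambda>x. u x - v x) x = weighted_grad u x + - weighted_grad v x"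
    "weighted_grad (\<lambda>x. v x - u x) x = weighted_grad v x - weighted_grad u x" for x
    using weighted_grad_diff[of u x v] weighted_grad_diff[of v x u] u v
    by (cases "x = 0"; auto simp: hardy_class_differentiable)+
  have int: "integrable lborel (\<lambda>x. (norm (weighted_grad u x))\<^sup>2)" "integrable lborel (\<lambda>x. (norm (weighted_grad v x))\<^sup>2)"
    using u v by (auto simp: hardy_class_def)
  show "calH_prenorm \<Omega> (\<lambda>x. u x - v x) \<le> calH_prenorm \<Omega> u + calH_prenorm \<Omega> v"
    using L2_norm_triangle[of "weighted_grad u" lborel "\<lambda>x. - weighted_grad v x"]
      hardy_class_measurable(2)[OF u] hardy_class_measurable(2)[OF v] int
    unfolding calH_prenorm_hardy_class[OF u \<Omega>] calH_prenorm_hardy_class[OF v \<Omega>]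
      calH_prenorm_hardy_class[OF hardy_class_diff[OF u v] \<Omega>] e
    by simp
  show "calH_prenorm \<Omega> (\<lambda>x. u x - v x) = calH_prenorm \<Omega> (\<lambda>x. v x - u x)"
    using u v by (simp add: calH_prenorm_hardy_class[OF _ \<Omega>] hardy_class_diff e norm_minus_commute)
qed

text \<open>
  On its support, of radius \<open>R\<close> say, a bounded function is bounded by a multiple of the weight
  \<open>|x| powr (-a)\<close>. Its weighted gradient grows at most like \<open>1 / |x|\<close>, which is square integrable near the
  origin as \<open>N \<ge> 3\<close>.
\<close>

lemma test_functions_subset_hardy_class:
  fixes \<Omega> :: "'a::euclidean_space set"
  assumes N: "DIM('a) \<ge> 3"
  shows "test_functions \<Omega> \<subseteq> hardy_class \<Omega>"
proof
  fix \<phi> assume \<phi>: "\<phi> \<in> test_functions \<Omega>"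
  define a where "a = (real DIM('a) - 2) / 2"
  have a: "a > 0" using N by (simp add: a_def)
  obtain B R where B: "B > 0" "R \<ge> 1" "\<And>x. \<bar>\<phi> x\<bar> \<le> B" "\<And>x. norm (grad \<phi> x) \<le> B"
    "\<And>x. x \<in> closure {x. \<phi> x \<noteq> 0} \<Longrightarrow> norm x \<le> R"
    using test_function_bounds[OF \<phi>] by metis
  have sm: "smooth_on UNIV \<phi>" using \<phi> by (simp add: test_functions_iff)
  then have sm0: "smooth_on (- {0}) \<phi>" by (rule smooth_on_subset) simp
  note [measurable] = smooth_off_0_measurable[OF sm0]
  have supp: "norm x \<le> R" if "\<phi> x \<noteq> 0" for x
    using B(5) that closure_subset[of "{x. \<phi> x \<noteq> 0}"] by blast
  have bound: "\<bar>\<phi> x\<bar> \<le> (B * R powr a) * norm x powr (- a)" if x: "x \<noteq> 0" for x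
  proof (cases "\<phi> x = 0")
    case False
    have "1 \<le> R powr a * norm x powr (- a)"
      using powr_mono2[of a "norm x" R] supp[OF False] x a by (simp add: powr_minus_divide)
    then have "B * 1 \<le> B * (R powr a * norm x powr (- a))" using B(1) by (intro mult_left_mono) auto
    then show ?thesis using B(3)[of x] by (simp only: mult.assoc mult_1_right)
  qed (use B in simp)
  have int: "integrable lborel (\<lambda>x. (norm (weighted_grad \<phi> x))\<^sup>2)"
  proof (rule integrable_bounded_by_norm_powr[where s=2 and C="(B * R + a * B)\<^sup>2" and R=R])
    fix x :: 'a assume x: "x \<noteq> 0"
    show "norm ((norm (weighted_grad \<phi> x))\<^sup>2) \<le> indicator (cball 0 R) x * ((B * R + a * B)\<^sup>2 * norm x powr - 2)"
    proof (cases "norm x \<le> R")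
      case True
      have "norm (weighted_grad \<phi> x) \<le> norm (grad \<phi> x) + norm ((a * \<phi> x / (norm x)\<^sup>2) *\<^sub>R x)"
        unfolding weighted_grad_eq[OF x smooth_on_imp_differentiable[OF sm UNIV_I], folded a_def]
        by (rule norm_triangle_ineq)
      also have "norm ((a * \<phi> x / (norm x)\<^sup>2) *\<^sub>R x) = a * \<bar>\<phi> x\<bar> / norm x"
        using x a by (simp add: abs_mult power2_eq_square)
      also have "norm (grad \<phi> x) + a * \<bar>\<phi> x\<bar> / norm x \<le> B * R / norm x + a * B / norm x"
      proof (intro add_mono divide_right_mono mult_left_mono)
        have "norm (grad \<phi> x) * norm x \<le> B * R" using True B by (intro mult_mono) auto
        then show "norm (grad \<phi> x) \<le> B * R / norm x" using x by (simp add: field_simps)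
      qed (use B a in auto)
      finally have "(norm (weighted_grad \<phi> x))\<^sup>2 \<le> ((B * R + a * B) / norm x)\<^sup>2"
        by (intro power_mono) (auto simp: add_divide_distrib)
      then show ?thesis using True x by (simp add: power_divide powr_minus_divide)
    next
      case False
      then have "x \<notin> closure {y. \<phi> y \<noteq> 0}" using B(5) by blast
      then show ?thesis using False by (simp add: weighted_grad_eq_0)
    qed
  qed (use N in auto)
  show "\<phi> \<in> hardy_class \<Omega>"
    using \<phi> sm0 bound int by (auto simp: hardy_class_def test_functions_iff a_def)
qed

text \<open>
  For \<open>u = |x| powr (-a) * v\<close> the weighted gradient is \<open>|x| powr (-a)\<close> times the gradient of \<open>v\<close>,
  hence square integrable because \<open>2 a < N\<close>.
\<close>

lemma calH_core_subset_hardy_class: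
  fixes \<Omega> :: "'a::euclidean_space set"
  assumes N: "DIM('a) \<ge> 3"
  shows "calH_core \<Omega> \<subseteq> hardy_class \<Omega>"
proof
  fix u assume "u \<in> calH_core \<Omega>"
  define a where "a = (real DIM('a) - 2) / 2"
  have a: "a > 0" using N by (simp add: a_def)
  obtain v where v: "v \<in> test_functions \<Omega>" and u: "u = (\<lambda>x. norm x powr (- a) * v x)"
    using \<open>u \<in> calH_core \<Omega>\<close> by (auto simp: calH_core_def a_def)
  obtain B R where B: "B > 0" "R \<ge> 1" "\<And>x. \<bar>v x\<bar> \<le> B" "\<And>x. norm (grad v x) \<le> B"
    "\<And>x. x \<in> closure {x. v x \<noteq> 0} \<Longrightarrow> norm x \<le> R"
    using test_function_bounds[OF v] by metis
  have sm: "smooth_on UNIV v" using v by (simp add: test_functions_iff)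
  have sm0: "smooth_on (- {0}) u"
    unfolding u by (intro smooth_on_mult smooth_on_norm_powr smooth_on_subset[OF sm]) auto
  note [measurable] = smooth_off_0_measurable[OF sm0]
  have supp: "compact (closure {x. u x \<noteq> 0})" "closure {x. u x \<noteq> 0} \<subseteq> \<Omega>"
    using support_mono[of v \<Omega> u] v by (auto simp: test_functions_iff u)
  have bound: "\<bar>u x\<bar> \<le> B * norm x powr (- a)" for x
    using mult_right_mono[OF B(3)[of x], of "norm x powr (- a)"] by (simp add: u abs_mult mult.commute)
  have wg: "weighted_grad u x = norm x powr (- a) *\<^sub>R grad v x" if x: "x \<noteq> 0" for x
  proof -
    have "norm y powr a * u y = v y" if "y \<noteq> 0" for y
      using that by (simp add: u mult.assoc[symmetric] powr_add[symmetric])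
    then have "grad (\<lambda>y. norm y powr a * u y) x = grad v x"
      by (intro grad_eqI GDERIV_transform_within_open[OF GDERIV_grad[OF smooth_on_imp_differentiable[OF sm]], of x "- {0}"])
        (use x in auto)
    then show ?thesis by (simp add: weighted_grad_def a_def)
  qed
  have int: "integrable lborel (\<lambda>x. (norm (weighted_grad u x))\<^sup>2)"
  proof (rule integrable_bounded_by_norm_powr[where s="2 * a" and C="B\<^sup>2" and R=R])
    fix x :: 'a assume x: "x \<noteq> 0"
    have "(norm (weighted_grad u x))\<^sup>2 = (norm (grad v x))\<^sup>2 * norm x powr (- (2 * a))"
      using wg[OF x] by (simp add: power_mult_distrib power2_eq_square powr_add[symmetric])
    also have "\<dots> \<le> indicator (cball 0 R) x * (B\<^sup>2 * norm x powr (- (2 * a)))"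
    proof (cases "norm x \<le> R")
      case True
      then show ?thesis using power_mono[OF B(4)[of x], of 2] by (simp add: mult_right_mono)
    next
      case False
      then have "grad v x = 0" using B(5) by (intro grad_eq_0) blast
      then show ?thesis by simp
    qed
    finally show "norm ((norm (weighted_grad u x))\<^sup>2) \<le> indicator (cball 0 R) x * (B\<^sup>2 * norm x powr (- (2 * a)))"
      by simp
  qed (use N in \<open>auto simp: a_def\<close>)
  show "u \<in> hardy_class \<Omega>"
    using sm0 supp bound int by (auto simp: hardy_class_def a_def)
qed

text \<open>
  If \<open>\<phi>\<close> vanishes near the origin, then so does \<open>v = |x| powr a * \<phi>\<close>, which is therefore smooth everywhere.
\<close>

lemma punctured_test_functions_subset_calH_core:
  fixes \<Omega> :: "'a::euclidean_space set"
  shows "test_functions (\<Omega> - {0}) \<subseteq> calH_core \<Omega>"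
proof
  fix \<phi> assume \<phi>: "\<phi> \<in> test_functions (\<Omega> - {0})"
  define a where "a = (real DIM('a) - 2) / 2"
  define v where "v = (\<lambda>x. norm x powr a * \<phi> x)"
  let ?K = "closure {x. \<phi> x \<noteq> 0}"
  have K: "compact ?K" "?K \<subseteq> \<Omega> - {0}" and sm: "smooth_on UNIV \<phi>" using \<phi> by (auto simp: test_functions_iff)
  have \<phi>0: "\<phi> x = 0" if "x \<notin> ?K" for x using that closure_subset[of "{x. \<phi> x \<noteq> 0}"] by blast
  have "smooth_on (- {0} \<union> - ?K) v"
  proof (rule smooth_on_Un)
    show "smooth_on (- {0}) v"
      unfolding v_def by (intro smooth_on_mult smooth_on_norm_powr smooth_on_subset[OF sm]) auto
    show "smooth_on (- ?K) v"
    proof (rule smooth_on_cong[OF _ _ smooth_on_const[of _ 0]])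
      show "0 = v x" if "x \<in> - ?K" for x using \<phi>0[of x] that by (simp add: v_def)
    qed (rule open_Compl[OF closed_closure])
  qed (rule open_Compl, simp)+
  also have "- {0} \<union> - ?K = UNIV" using K(2) by auto
  finally have "v \<in> test_functions \<Omega>"
    using support_mono[of \<phi> \<Omega> v] K by (auto simp: test_functions_iff v_def)
  moreover have "\<phi> = (\<lambda>x. norm x powr (- a) * v x)"
  proof
    fix x show "\<phi> x = norm x powr (- a) * v x"
      using K(2) \<phi>0[of 0] by (cases "x = 0") (auto simp: v_def mult.assoc[symmetric] powr_add[symmetric])
  qed
  ultimately show "\<phi> \<in> calH_core \<Omega>" by (auto simp: calH_core_def a_def)
qed

section \<open>Density of the test functions that vanish near the origin\<close>

text \<open>
  The cutoff \<open>\<theta> (- ln |x| / k)\<close>, with \<open>\<theta>\<close> a smooth step function, has a gradient of size \<open>1 / (k |x|)\<close>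
  on an annulus of logarithmic width \<open>k\<close>.
\<close>

lemma log_cutoff_exists:
  obtains \<eta> :: "nat \<Rightarrow> 'a::euclidean_space \<Rightarrow> real" and \<eta>' :: "nat \<Rightarrow> 'a \<Rightarrow> 'a" and B :: real
  where "\<And>k. k \<ge> 1 \<Longrightarrow> smooth_on (- {0}) (\<eta> k)"
    and "\<And>k x. k \<ge> 1 \<Longrightarrow> x \<noteq> 0 \<Longrightarrow> GDERIV (\<eta> k) x :> \<eta>' k x"
    and "\<And>k x. 0 \<le> \<eta> k x \<and> \<eta> k x \<le> 1"
    and "\<And>k x. k \<ge> 1 \<Longrightarrow> norm x \<le> exp (- (2 * real k)) \<Longrightarrow> \<eta> k x = 0"
    and "\<And>k x. k \<ge> 1 \<Longrightarrow> norm x \<ge> exp (- real k) \<Longrightarrow> \<eta> k x = 1"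
    and "\<And>k x. k \<ge> 1 \<Longrightarrow> x \<noteq> 0 \<Longrightarrow> norm (\<eta>' k x) \<le>
        B / real k * norm x powr (- 1) * indicator {x. exp (- (2 * real k)) \<le> norm x \<and> norm x \<le> exp (- real k)} x"
proof -
  obtain \<theta> \<theta>' :: "real \<Rightarrow> real" and B where \<theta>: "smooth_on UNIV \<theta>" "\<And>t. (\<theta> has_real_derivative \<theta>' t) (at t)"
    "\<And>t. t \<le> 1 \<Longrightarrow> \<theta> t = 1" "\<And>t. 2 \<le> t \<Longrightarrow> \<theta> t = 0" "\<And>t. 0 \<le> \<theta> t \<and> \<theta> t \<le> 1"
    "\<And>t. \<bar>\<theta>' t\<bar> \<le> B" "\<And>t. t \<notin> {1..2} \<Longrightarrow> \<theta>' t = 0"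
    using smooth_step_exists by metis
  define \<tau> where "\<tau> = (\<lambda>k (x::'a). - inverse (real k) * ln (norm x))"
  \<comment> \<open>The value at the origin is set by hand: since \<open>ln 0 = 0\<close>, the formula would give \<open>1\<close> there.\<close>
  define \<eta> where "\<eta> = (\<lambda>k (x::'a). if x = 0 then 0 else \<theta> (\<tau> k x))"
  define \<eta>' where "\<eta>' = (\<lambda>k (x::'a). \<theta>' (\<tau> k x) *\<^sub>R (- inverse (real k) * inverse (norm x)) *\<^sub>R sgn x)"
  have tau1: "norm x \<le> exp (- real k)" "x \<noteq> 0" if "1 \<le> \<tau> k x" "k \<ge> 1" for k x
  proof -
    have l: "ln (norm x) \<le> - real k" using that by (simp add: \<tau>_def field_simps)
    then show x: "x \<noteq> 0" using that by auto
    then show "norm x \<le> exp (- real k)" using l exp_le_cancel_iff[of "ln (norm x)" "- real k"] by simp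
  qed
  have tau2: "exp (- (2 * real k)) \<le> norm x" if "\<tau> k x \<le> 2" "k \<ge> 1" "x \<noteq> 0" for k x
  proof -
    have l: "- (2 * real k) \<le> ln (norm x)" using that by (simp add: \<tau>_def field_simps)
    then show ?thesis using exp_le_cancel_iff[of "- (2 * real k)" "ln (norm x)"] that by simp
  qed
  have g: "GDERIV (\<lambda>x. \<theta> (\<tau> k x)) x :> \<eta>' k x" if "x \<noteq> 0" for k and x :: 'a
  proof -
    have "((\<lambda>r. - inverse (real k) * ln r) has_real_derivative - inverse (real k) * inverse (norm x)) (at (norm x))"
      using that by (auto intro!: derivative_eq_intros simp: divide_inverse)
    from GDERIV_DERIV_compose[OF GDERIV_DERIV_compose[OF GDERIV_norm[OF that] this] \<theta>(2)]
    show ?thesis by (simp add: \<eta>'_def \<tau>_def)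
  qed
  show thesis
  proof (rule that[of \<eta> \<eta>' B])
    fix k :: nat assume k: "k \<ge> 1"
    have "smooth_on (- {0}) (\<tau> k)"
      unfolding \<tau>_def
      by (intro smooth_on_mult smooth_on_const smooth_on_compose[OF _ _ smooth_on_ln smooth_on_norm]) auto
    then have "smooth_on (- {0}) (\<lambda>x. \<theta> (\<tau> k x))"
      by (intro smooth_on_compose[OF _ _ \<theta>(1)]) auto
    then show "smooth_on (- {0}) (\<eta> k)"
      by (rule smooth_on_cong[rotated 2]) (auto simp: \<eta>_def)
    show "\<eta> k x = 0" if "norm x \<le> exp (- (2 * real k))" for x
    proof (cases "\<tau> k x \<ge> 2")
      case False
      show ?thesis
      proof (cases "x = 0")
        case nz: False
        have "norm x = exp (- (2 * real k))" using tau2[of k x] False k that nz by simp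
        then have "\<tau> k x = 2" using k by (simp add: \<tau>_def)
        then show ?thesis using False by simp
      qed (simp add: \<eta>_def)
    qed (simp add: \<eta>_def \<theta>(4))
    show "\<eta> k x = 1" if n: "norm x \<ge> exp (- real k)" for x
    proof -
      have nz: "x \<noteq> 0" using n by (auto simp: not_le)
      have "\<tau> k x \<le> 1"
      proof (rule ccontr)
        assume "\<not> \<tau> k x \<le> 1"
        then have "norm x = exp (- real k)" using tau1(1)[of k x] k n by simp
        then have "\<tau> k x = 1" using k by (simp add: \<tau>_def)
        then show False using \<open>\<not> \<tau> k x \<le> 1\<close> by simp
      qed
      then show ?thesis using nz by (simp add: \<eta>_def \<theta>(3))
    qed
    fix x :: 'a assume x: "x \<noteq> 0"
    show "GDERIV (\<eta> k) x :> \<eta>' k x"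
      by (rule GDERIV_transform_within_open[OF g[OF x], of "- {0}"]) (use x in \<open>auto simp: \<eta>_def\<close>)
    let ?A = "{x::'a. exp (- (2 * real k)) \<le> norm x \<and> norm x \<le> exp (- real k)}"
    show "norm (\<eta>' k x) \<le> B / real k * norm x powr (- 1) * indicator ?A x"
    proof (cases "\<tau> k x \<in> {1..2}")
      case True
      then have "x \<in> ?A" using tau1(1)[of k x] tau2[of k x] k x by simp
      moreover have "norm (\<eta>' k x) = \<bar>\<theta>' (\<tau> k x)\<bar> * (inverse (real k) * inverse (norm x))"
        using x by (simp add: \<eta>'_def norm_sgn abs_mult)
      moreover have "\<dots> \<le> B * (inverse (real k) * inverse (norm x))"
        by (intro mult_right_mono \<theta>(6)) simp
      ultimately show ?thesis using x by (simp add: powr_neg_one divide_inverse mult.assoc)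
    next
      case False
      have "B \<ge> 0" using \<theta>(6)[of 0] by linarith
      then show ?thesis using \<theta>(7)[OF False] by (simp add: \<eta>'_def)
    qed
  qed (auto simp: \<eta>_def \<theta>(5))
qed

text \<open>
  The weighted gradient of \<open>(1 - \<eta>) u\<close> is \<open>(1 - \<eta>)\<close> times that of \<open>u\<close>, minus \<open>u\<close> times the gradient of the
  cutoff \<open>\<eta>\<close>. The first part tends to \<open>0\<close> in \<open>L\<^sup>2\<close> by dominated convergence. With \<open>|u| \<le> C |x| powr (-a)\<close> the
  square of the second is at most a constant times \<open>|x| powr (-N) / k\<^sup>2\<close> on the annulus, whose integral is
  of order \<open>1 / k\<close>.
\<close>

lemma hardy_class_approx:
  fixes \<Omega> :: "'a::euclidean_space set"
  assumes N: "DIM('a) \<ge> 3" and \<Omega>: "\<Omega> \<in> sets borel" and u: "u \<in> hardy_class \<Omega>" and e: "0 < e"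
  shows "\<exists>w\<in>test_functions (\<Omega> - {0}). calH_prenorm \<Omega> (\<lambda>x. u x - w x) < e \<and>
    (LINT x|lebesgue_on \<Omega>. (u x - w x)\<^sup>2) < e"
proof -
  define a where "a = (real DIM('a) - 2) / 2"
  define A where "A k = {x::'a. exp (- (2 * real k)) \<le> norm x \<and> norm x \<le> exp (- real k)}" for k
  obtain \<eta> :: "nat \<Rightarrow> 'a \<Rightarrow> real" and \<eta>' :: "nat \<Rightarrow> 'a \<Rightarrow> 'a" and B where
    sm: "\<And>k. k \<ge> 1 \<Longrightarrow> smooth_on (- {0}) (\<eta> k)"
    and d: "\<And>k x. k \<ge> 1 \<Longrightarrow> x \<noteq> 0 \<Longrightarrow> GDERIV (\<eta> k) x :> \<eta>' k x"
    and b: "\<And>k x. 0 \<le> \<eta> k x \<and> \<eta> k x \<le> 1"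
    and zero: "\<And>k x. k \<ge> 1 \<Longrightarrow> norm x \<le> exp (- (2 * real k)) \<Longrightarrow> \<eta> k x = 0"
    and one: "\<And>k x. k \<ge> 1 \<Longrightarrow> norm x \<ge> exp (- real k) \<Longrightarrow> \<eta> k x = 1"
    and d_le: "\<And>k x. k \<ge> 1 \<Longrightarrow> x \<noteq> 0 \<Longrightarrow> norm (\<eta>' k x) \<le> B / real k * norm x powr (- 1) * indicator (A k) x"
    using that by (rule log_cutoff_exists[where 'a='a, folded A_def])
  obtain C where C: "\<And>x. x \<noteq> 0 \<Longrightarrow> \<bar>u x\<bar> \<le> C * norm x powr (- a)"
    using u by (auto simp: hardy_class_def a_def)
  have smu: "smooth_on (- {0}) u" and intG: "integrable lborel (\<lambda>x. (norm (weighted_grad u x))\<^sup>2)"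
    using u by (auto simp: hardy_class_def)
  note [measurable] = hardy_class_measurable[OF u]
  define w where "w k x = u x * \<eta> k x" for k x
  have w_test: "w k \<in> test_functions (\<Omega> - {0})" if k: "k \<ge> 1" for k
  proof -
    let ?r = "exp (- (2 * real k))"
    have "smooth_on (- {0} \<union> ball 0 ?r) (w k)"
    proof (rule smooth_on_Un)
      show "smooth_on (- {0}) (w k)" unfolding w_def by (intro smooth_on_mult smu sm k) auto
      show "smooth_on (ball 0 ?r) (w k)"
        by (rule smooth_on_cong[OF _ _ smooth_on_const[of _ 0]]) (auto simp: w_def zero[OF k])
    qed auto
    also have "- {0} \<union> ball 0 ?r = (UNIV :: 'a set)" by auto
    finally have "smooth_on UNIV (w k)" .
    moreover have supp: "compact (closure {x. w k x \<noteq> 0})" "closure {x. w k x \<noteq> 0} \<subseteq> \<Omega>"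
      using support_mono[of u \<Omega> "w k"] u by (auto simp: hardy_class_def w_def)
    moreover have "closure {x. w k x \<noteq> 0} \<subseteq> - ball 0 ?r"
      by (rule closure_minimal) (auto simp: w_def zero[OF k])
    then have "0 \<notin> closure {x. w k x \<noteq> 0}" by auto
    ultimately show ?thesis by (auto simp: test_functions_iff)
  qed
  have w_class: "w k \<in> hardy_class \<Omega>" if "k \<ge> 1" for k
  proof -
    have "test_functions (\<Omega> - {0}) \<subseteq> test_functions \<Omega>" by (auto simp: test_functions_iff)
    then show ?thesis using w_test[OF that] test_functions_subset_hardy_class[OF N] by blast
  qed
  have wg: "weighted_grad (\<lambda>x. u x - w k x) x = (1 - \<eta> k x) *\<^sub>R weighted_grad u x - u x *\<^sub>R \<eta>' k x"
    if k: "k \<ge> 1" and x: "x \<noteq> 0" for k x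
  proof -
    have du: "GDERIV u x :> grad u x" by (rule GDERIV_grad[OF hardy_class_differentiable[OF u x]])
    have "GDERIV (w k) x :> u x *\<^sub>R \<eta>' k x + \<eta> k x *\<^sub>R grad u x"
      unfolding w_def by (rule GDERIV_mult[OF du d[OF k x]])
    then have g: "grad (w k) x = u x *\<^sub>R \<eta>' k x + \<eta> k x *\<^sub>R grad u x" by (rule grad_eqI)
    define c where "c = (real DIM('a) - 2) / 2 * u x / (norm x)\<^sup>2"
    have c: "(real DIM('a) - 2) / 2 * w k x / (norm x)\<^sup>2 = \<eta> k x * c" by (simp add: c_def w_def)
    show ?thesis
      unfolding weighted_grad_diff[OF hardy_class_differentiable[OF u x] hardy_class_differentiable[OF w_class[OF k] x]]
        weighted_grad_eq[OF x hardy_class_differentiable[OF u x]]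
        weighted_grad_eq[OF x hardy_class_differentiable[OF w_class[OF k] x]] g c c_def[symmetric]
      by (simp add: algebra_simps)
  qed
  have lim1: "(\<lambda>k. 1 - \<eta> k x) \<longlonglongrightarrow> 0" if "x \<noteq> 0" for x
  proof (rule tendsto_eventually)
    have "(\<lambda>k. exp (- real k)) \<longlonglongrightarrow> 0"
      by (intro filterlim_compose[OF exp_at_bot] filterlim_uminus_at_bot_at_top[THEN filterlim_compose] filterlim_real_sequentially)
    then have "\<forall>\<^sub>F k in sequentially. exp (- real k) < norm x"
      by (rule order_tendstoD(2)) (use that in simp)
    then show "\<forall>\<^sub>F k in sequentially. 1 - \<eta> k x = 0"
      using eventually_ge_at_top[of 1] by eventually_elim (use one in auto)
  qed
  have dct: "(\<lambda>k. \<integral>x. (1 - \<eta> (Suc k) x)\<^sup>2 * f x \<partial>lborel) \<longlonglongrightarrow> 0"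
    if f: "integrable lborel f" "\<And>x. f x \<ge> 0" for f :: "'a \<Rightarrow> real"
  proof -
    have [measurable]: "\<eta> (Suc k) \<in> borel_measurable borel" for k
      using smooth_off_0_measurable(1)[OF sm] by simp
    have [measurable]: "f \<in> borel_measurable lborel" using f by auto
    have "(\<lambda>k. \<integral>x. (1 - \<eta> (Suc k) x)\<^sup>2 * f x \<partial>lborel) \<longlonglongrightarrow> integral\<^sup>L (lborel :: 'a measure) (\<lambda>_. 0)"
    proof (rule integral_dominated_convergence[OF _ _ f(1)])
      show "AE x in lborel. (\<lambda>k. (1 - \<eta> (Suc k) x)\<^sup>2 * f x) \<longlonglongrightarrow> 0"
        using AE_lborel_singleton[of 0]
      proof eventually_elim
        case (elim x)
        have "(\<lambda>k. (1 - \<eta> (Suc k) x)\<^sup>2 * f x) \<longlonglongrightarrow> 0\<^sup>2 * f x"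
          by (intro tendsto_mult tendsto_power LIMSEQ_Suc[OF lim1] tendsto_const) (use elim in simp)
        then show ?case by simp
      qed
      show "AE x in lborel. norm ((1 - \<eta> (Suc k) x)\<^sup>2 * f x) \<le> f x" for k
      proof (rule AE_I2)
        fix x
        have "(1 - \<eta> (Suc k) x)\<^sup>2 \<le> 1" using b[of "Suc k" x] by (simp add: power_le_one)
        then show "norm ((1 - \<eta> (Suc k) x)\<^sup>2 * f x) \<le> f x"
          using mult_right_mono[of _ 1 "f x"] f(2)[of x] by simp
      qed
    qed auto
    then show ?thesis by simp
  qed
  define E where "E k = (\<integral>x. (norm (weighted_grad (\<lambda>x. u x - w (Suc k) x) x))\<^sup>2 \<partial>lborel)" for k
  define V where "V = unit_ball_vol (real DIM('a)) * exp (real DIM('a))"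
  have E_le: "E k \<le> 2 * (\<integral>x. (1 - \<eta> (Suc k) x)\<^sup>2 * (norm (weighted_grad u x))\<^sup>2 \<partial>lborel)
      + 2 * (C * B)\<^sup>2 * V * ((real (Suc k) + 1) / (real (Suc k))\<^sup>2)" for k
  proof -
    let ?k = "Suc k"
    have [measurable]: "\<eta> ?k \<in> borel_measurable borel"
      using smooth_off_0_measurable(1)[OF sm] by simp
    let ?f = "\<lambda>x. (1 - \<eta> ?k x)\<^sup>2 * (norm (weighted_grad u x))\<^sup>2"
    let ?g = "\<lambda>x. indicator (A ?k) x * norm x powr (- real DIM('a))"
    have pw: "(norm (weighted_grad (\<lambda>x. u x - w ?k x) x))\<^sup>2 \<le> 2 * ?f x + 2 * (C * B / real ?k)\<^sup>2 * ?g x" for x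
    proof (cases "x = 0")
      case x: False
      have C0: "0 \<le> C * norm x powr (- a)" using C[OF x] abs_ge_zero order_trans by blast
      have "norm (u x *\<^sub>R \<eta>' ?k x) \<le> (C * norm x powr (- a)) * (B / real ?k * norm x powr (- 1) * indicator (A ?k) x)"
        unfolding norm_scaleR by (intro mult_mono C[OF x] d_le x C0) auto
      also have "\<dots> = (C * B / real ?k) * (norm x powr (- a - 1) * indicator (A ?k) x)"
        using powr_add[of "norm x" "- a" "- 1"] by (simp only: diff_conv_add_uminus mult_ac times_divide_eq_left times_divide_eq_right)
      finally have "(norm (u x *\<^sub>R \<eta>' ?k x))\<^sup>2 \<le> ((C * B / real ?k) * (norm x powr (- a - 1) * indicator (A ?k) x))\<^sup>2"
        by (intro power_mono) auto
      also have "\<dots> = (C * B / real ?k)\<^sup>2 * ?g x"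
      proof -
        have "(norm x powr (- a - 1))\<^sup>2 = norm x powr (- real DIM('a))"
          by (simp add: power2_eq_square powr_add[symmetric] a_def)
        then show ?thesis by (simp add: power_mult_distrib power_divide indicator_def)
      qed
      finally have le: "(norm (u x *\<^sub>R \<eta>' ?k x))\<^sup>2 \<le> (C * B / real ?k)\<^sup>2 * ?g x" .
      have "(norm (weighted_grad (\<lambda>x. u x - w ?k x) x))\<^sup>2
          \<le> (norm ((1 - \<eta> ?k x) *\<^sub>R weighted_grad u x) + norm (u x *\<^sub>R \<eta>' ?k x))\<^sup>2"
        unfolding wg[OF _ x, of ?k, simplified] by (intro power_mono norm_triangle_ineq4) simp
      also have "\<dots> \<le> 2 * (norm ((1 - \<eta> ?k x) *\<^sub>R weighted_grad u x))\<^sup>2 + 2 * (norm (u x *\<^sub>R \<eta>' ?k x))\<^sup>2"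
        using sum_squares_bound[of "norm ((1 - \<eta> ?k x) *\<^sub>R weighted_grad u x)" "norm (u x *\<^sub>R \<eta>' ?k x)"]
        by (simp add: power2_sum)
      also have "(norm ((1 - \<eta> ?k x) *\<^sub>R weighted_grad u x))\<^sup>2 = ?f x" by (simp add: power_mult_distrib)
      finally show ?thesis using le by linarith
    qed simp
    have if_: "integrable lborel ?f"
    proof (rule Bochner_Integration.integrable_bound[OF intG])
      show "AE x in lborel. norm (?f x) \<le> norm ((norm (weighted_grad u x))\<^sup>2)"
      proof (rule AE_I2)
        fix x
        have "(1 - \<eta> ?k x)\<^sup>2 \<le> 1" using b[of ?k x] by (simp add: power_le_one)
        then show "norm (?f x) \<le> norm ((norm (weighted_grad u x))\<^sup>2)"
          using mult_right_mono[of _ 1 "(norm (weighted_grad u x))\<^sup>2"] by simp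
      qed
    qed simp
    have ig: "integrable lborel ?g" "(\<integral>x. ?g x \<partial>lborel) \<le> V * (real ?k + 1)"
      unfolding A_def V_def by (rule integral_norm_powr_annulus)+
    have "E k \<le> (\<integral>x. 2 * ?f x + 2 * (C * B / real ?k)\<^sup>2 * ?g x \<partial>lborel)"
      unfolding E_def
    proof (rule integral_mono)
      show "integrable lborel (\<lambda>x. (norm (weighted_grad (\<lambda>x. u x - w ?k x) x))\<^sup>2)"
        using hardy_class_diff[OF u w_class[of ?k]] by (simp add: hardy_class_def)
    qed (use if_ ig pw in auto)
    also have "\<dots> = 2 * (\<integral>x. ?f x \<partial>lborel) + 2 * (C * B / real ?k)\<^sup>2 * (\<integral>x. ?g x \<partial>lborel)"
      using if_ ig(1) by (subst Bochner_Integration.integral_add) auto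
    also have "2 * (C * B / real ?k)\<^sup>2 * (\<integral>x. ?g x \<partial>lborel) \<le> 2 * (C * B / real ?k)\<^sup>2 * (V * (real ?k + 1))"
      by (intro mult_left_mono ig) simp
    also have "2 * (C * B / real ?k)\<^sup>2 * (V * (real ?k + 1)) = 2 * (C * B)\<^sup>2 * V * ((real ?k + 1) / (real ?k)\<^sup>2)"
      by (simp add: power_divide)
    finally show ?thesis by simp
  qed
  have E0: "E \<longlonglongrightarrow> 0"
  proof (rule Lim_null_comparison)
    have "(\<lambda>k. (real (Suc k) + 1) / (real (Suc k))\<^sup>2) = (\<lambda>k. inverse (real (Suc k)) + inverse (real (Suc k)) * inverse (real (Suc k)))"
    proof
      have h: "(n + 1) / n\<^sup>2 = inverse n + inverse n * inverse n" if "n > 0" for n :: real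
        using that by (simp add: field_simps power2_eq_square)
      show "(real (Suc k) + 1) / (real (Suc k))\<^sup>2 = inverse (real (Suc k)) + inverse (real (Suc k)) * inverse (real (Suc k))" for k
        by (rule h) simp
    qed
    then have *: "(\<lambda>k. (real (Suc k) + 1) / (real (Suc k))\<^sup>2) \<longlonglongrightarrow> 0"
      using tendsto_add[OF LIMSEQ_inverse_real_of_nat tendsto_mult[OF LIMSEQ_inverse_real_of_nat LIMSEQ_inverse_real_of_nat]] by simp
    show "(\<lambda>k. 2 * (\<integral>x. (1 - \<eta> (Suc k) x)\<^sup>2 * (norm (weighted_grad u x))\<^sup>2 \<partial>lborel)
      + 2 * (C * B)\<^sup>2 * V * ((real (Suc k) + 1) / (real (Suc k))\<^sup>2)) \<longlonglongrightarrow> 0"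
      using tendsto_add[OF tendsto_mult_left[OF dct[OF intG], of 2] tendsto_mult_left[OF *, of "2 * (C * B)\<^sup>2 * V"]] by simp
    show "\<forall>\<^sub>F k in sequentially. norm (E k) \<le> 2 * (\<integral>x. (1 - \<eta> (Suc k) x)\<^sup>2 * (norm (weighted_grad u x))\<^sup>2 \<partial>lborel)
      + 2 * (C * B)\<^sup>2 * V * ((real (Suc k) + 1) / (real (Suc k))\<^sup>2)"
    proof (intro always_eventually allI)
      fix k
      have "norm (E k) = E k" by (simp add: E_def)
      then show "norm (E k) \<le> 2 * (\<integral>x. (1 - \<eta> (Suc k) x)\<^sup>2 * (norm (weighted_grad u x))\<^sup>2 \<partial>lborel)
          + 2 * (C * B)\<^sup>2 * V * ((real (Suc k) + 1) / (real (Suc k))\<^sup>2)" using E_le[of k] by (rule ord_eq_le_trans)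
    qed
  qed
  have "calH_prenorm \<Omega> (\<lambda>x. u x - w (Suc k) x) = sqrt (E k)" for k
    unfolding E_def using calH_prenorm_hardy_class[OF hardy_class_diff[OF u w_class] \<Omega>] by simp
  then have q0: "(\<lambda>k. calH_prenorm \<Omega> (\<lambda>x. u x - w (Suc k) x)) \<longlonglongrightarrow> 0"
    using tendsto_real_sqrt[OF E0] by simp
  have "(LINT x|lebesgue_on \<Omega>. (u x - w (Suc k) x)\<^sup>2) = (\<integral>x. (1 - \<eta> (Suc k) x)\<^sup>2 * (u x)\<^sup>2 \<partial>lborel)" for k
  proof -
    note [measurable] = hardy_class_measurable[OF w_class[of "Suc k", simplified]]
    have "(LINT x|lebesgue_on \<Omega>. (u x - w (Suc k) x)\<^sup>2) = (\<integral>x. (u x - w (Suc k) x)\<^sup>2 \<partial>lborel)"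
      by (rule integral_lebesgue_on_eq_lborel(2)[OF \<Omega>]) (measurable, simp add: w_def hardy_class_vanish(1)[OF u])
    also have "\<dots> = (\<integral>x. (1 - \<eta> (Suc k) x)\<^sup>2 * (u x)\<^sup>2 \<partial>lborel)"
      by (simp add: w_def power2_eq_square algebra_simps)
    finally show ?thesis .
  qed
  then have l0: "(\<lambda>k. LINT x|lebesgue_on \<Omega>. (u x - w (Suc k) x)\<^sup>2) \<longlonglongrightarrow> 0"
    using dct[OF hardy_class_integrable_power2[OF u N]] by simp
  have "\<forall>\<^sub>F k in sequentially. calH_prenorm \<Omega> (\<lambda>x. u x - w (Suc k) x) < e \<and>
      (LINT x|lebesgue_on \<Omega>. (u x - w (Suc k) x)\<^sup>2) < e"
    by (intro eventually_conj order_tendstoD(2)[OF q0 e] order_tendstoD(2)[OF l0 e])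
  then obtain k where "calH_prenorm \<Omega> (\<lambda>x. u x - w (Suc k) x) < e"
      "(LINT x|lebesgue_on \<Omega>. (u x - w (Suc k) x)\<^sup>2) < e"
    unfolding eventually_sequentially by blast
  then show ?thesis using w_test[of "Suc k"] by auto
qed

section \<open>The two prenorms and the two spaces\<close>

text \<open>
  Off the origin the weighted gradient of \<open>\<phi>\<close> is \<open>\<nabla>\<phi> + a \<phi> x / |x|\<^sup>2\<close>. Squared, it gives \<open>|\<nabla>\<phi>|\<^sup>2\<close>, the cross
  term \<open>a (\<nabla>(\<phi>\<^sup>2) \<bullet> x) / |x|\<^sup>2\<close> and \<open>a\<^sup>2 \<phi>\<^sup>2 / |x|\<^sup>2\<close>. The dilation identity for \<open>g = \<phi>\<^sup>2\<close> turns the integral of the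
  cross term into \<open>-2 a\<^sup>2 \<integral> \<phi>\<^sup>2 / |x|\<^sup>2\<close>, and what remains is the Hardy functional.
\<close>

lemma H_prenorm_eq_calH_prenorm:
  fixes \<Omega> :: "'a::euclidean_space set"
  assumes N: "DIM('a) \<ge> 3" and \<Omega>: "\<Omega> \<in> sets borel" and \<phi>: "\<phi> \<in> test_functions \<Omega>"
  shows "H_prenorm \<Omega> \<phi> = calH_prenorm \<Omega> \<phi>"
proof -
  define a where "a = (real DIM('a) - 2) / 2"
  have cl: "\<phi> \<in> hardy_class \<Omega>" using \<phi> test_functions_subset_hardy_class[OF N] by blast
  have sm: "smooth_on UNIV \<phi>" using \<phi> by (simp add: test_functions_iff)
  obtain B R where R: "\<And>x. \<bar>\<phi> x\<bar> \<le> B" "\<And>x. norm (grad \<phi> x) \<le> B" "\<And>x. x \<in> closure {x. \<phi> x \<noteq> 0} \<Longrightarrow> norm x \<le> R"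
    using test_function_bounds[OF \<phi>] by metis
  note cont = smooth_on_imp_continuous_on[OF sm] smooth_on_imp_continuous_on_grad[OF sm]
  note [measurable] = borel_measurable_continuous_onI[OF cont(1)] borel_measurable_continuous_onI[OF cont(2)]
  have g: "GDERIV \<phi> x :> grad \<phi> x" for x
    by (rule GDERIV_grad[OF smooth_on_imp_differentiable[OF sm UNIV_I]])
  define D where "D x = (2 * \<phi> x) *\<^sub>R grad \<phi> x" for x
  have "GDERIV (\<lambda>x. (\<phi> x)\<^sup>2) x :> D x" for x
    unfolding power2_eq_square D_def mult_2 scaleR_left_distrib by (rule GDERIV_mult[OF g g])
  moreover have "continuous_on UNIV D" unfolding D_def by (intro continuous_intros cont)
  moreover have supp: "\<phi> x = 0" if "norm x > R" for x
    using R(3)[of x] that closure_subset[of "{x. \<phi> x \<noteq> 0}"] by force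
  ultimately have J: "integrable lborel (\<lambda>x. (\<phi> x)\<^sup>2 / (norm x)\<^sup>2)"
      "integrable lborel (\<lambda>x. (D x \<bullet> x) / (norm x)\<^sup>2)"
      "(\<integral>x. (D x \<bullet> x) / (norm x)\<^sup>2 \<partial>lborel) = (2 - real DIM('a)) * (\<integral>x. (\<phi> x)\<^sup>2 / (norm x)\<^sup>2 \<partial>lborel)"
    using integral_inverse_square_radial_derivative[OF N, of "\<lambda>x. (\<phi> x)\<^sup>2" D R] by auto
  have pw: "(norm (weighted_grad \<phi> x))\<^sup>2
      = (norm (grad \<phi> x))\<^sup>2 + a * ((D x \<bullet> x) / (norm x)\<^sup>2) + a\<^sup>2 * ((\<phi> x)\<^sup>2 / (norm x)\<^sup>2)" if x: "x \<noteq> 0" for x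
  proof -
    have expand: "(norm (p + c *\<^sub>R q))\<^sup>2 = (norm p)\<^sup>2 + 2 * c * (p \<bullet> q) + c\<^sup>2 * (norm q)\<^sup>2" for p q :: 'a and c
      unfolding power2_norm_eq_inner
      by (simp add: inner_add_left inner_add_right inner_commute power2_eq_square)
    have "weighted_grad \<phi> x = grad \<phi> x + (a * \<phi> x / (norm x)\<^sup>2) *\<^sub>R x"
      unfolding a_def by (rule weighted_grad_eq[OF x smooth_on_imp_differentiable[OF sm UNIV_I]])
    then have "(norm (weighted_grad \<phi> x))\<^sup>2 = (norm (grad \<phi> x))\<^sup>2 + 2 * (a * \<phi> x / (norm x)\<^sup>2) * (grad \<phi> x \<bullet> x)
        + (a * \<phi> x / (norm x)\<^sup>2)\<^sup>2 * (norm x)\<^sup>2"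
      using expand by simp
    also have "(a * \<phi> x / (norm x)\<^sup>2)\<^sup>2 * (norm x)\<^sup>2 = a\<^sup>2 * ((\<phi> x)\<^sup>2 / (norm x)\<^sup>2)"
      using x by (simp add: power_divide power_mult_distrib power2_eq_square)
    finally show ?thesis by (simp add: D_def)
  qed
  have int_grad: "integrable lborel (\<lambda>x. (norm (grad \<phi> x))\<^sup>2)"
  proof (rule integrable_bounded_by_norm_powr[where s=0 and C="B\<^sup>2" and R=R])
    fix x :: 'a assume "x \<noteq> 0"
    then show "norm ((norm (grad \<phi> x))\<^sup>2) \<le> indicator (cball 0 R) x * (B\<^sup>2 * norm x powr - 0)"
      using power_mono[OF R(2)[of x], of 2] R(3)[of x] grad_eq_0[of x \<phi>]
      by (cases "x \<in> closure {x. \<phi> x \<noteq> 0}") auto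
  qed (use N in auto)
  have out: "x \<notin> closure {x. \<phi> x \<noteq> 0}" if "x \<notin> \<Omega>" for x using \<phi> that by (auto simp: test_functions_iff)
  have "(\<integral>x. (norm (weighted_grad \<phi> x))\<^sup>2 \<partial>lborel)
      = (\<integral>x. (norm (grad \<phi> x))\<^sup>2 + a * ((D x \<bullet> x) / (norm x)\<^sup>2) + a\<^sup>2 * ((\<phi> x)\<^sup>2 / (norm x)\<^sup>2) \<partial>lborel)"
  proof (rule integral_cong_AE)
    show "AE x in lborel. (norm (weighted_grad \<phi> x))\<^sup>2
        = (norm (grad \<phi> x))\<^sup>2 + a * ((D x \<bullet> x) / (norm x)\<^sup>2) + a\<^sup>2 * ((\<phi> x)\<^sup>2 / (norm x)\<^sup>2)"
      using AE_lborel_singleton[of 0] by eventually_elim (rule pw)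
  qed (use hardy_class_measurable[OF cl] in \<open>simp_all add: D_def\<close>)
  also have "\<dots> = (\<integral>x. (norm (grad \<phi> x))\<^sup>2 \<partial>lborel) + a * (\<integral>x. (D x \<bullet> x) / (norm x)\<^sup>2 \<partial>lborel)
      + a\<^sup>2 * (\<integral>x. (\<phi> x)\<^sup>2 / (norm x)\<^sup>2 \<partial>lborel)"
    using int_grad J(1,2) by (simp del: times_divide_eq_right)
  also have "\<dots> = (\<integral>x. (norm (grad \<phi> x))\<^sup>2 \<partial>lborel) - a\<^sup>2 * (\<integral>x. (\<phi> x)\<^sup>2 / (norm x)\<^sup>2 \<partial>lborel)"
  proof -
    have "2 - real DIM('a) = - 2 * a" by (simp add: a_def)
    then show ?thesis unfolding J(3) by (simp add: power2_eq_square)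
  qed
  also have "\<dots> = hardy_functional \<Omega> \<phi>"
  proof -
    have "(LINT x|lebesgue_on \<Omega>. (norm (grad \<phi> x))\<^sup>2) = (\<integral>x. (norm (grad \<phi> x))\<^sup>2 \<partial>lborel)"
      by (rule integral_lebesgue_on_eq_lborel[OF \<Omega>]) (use grad_eq_0 out in auto)
    moreover have "(LINT x|lebesgue_on \<Omega>. (\<phi> x)\<^sup>2 / (norm x)\<^sup>2) = (\<integral>x. (\<phi> x)\<^sup>2 / (norm x)\<^sup>2 \<partial>lborel)"
      by (rule integral_lebesgue_on_eq_lborel[OF \<Omega>]) (use hardy_class_vanish(1)[OF cl] in auto)
    ultimately show ?thesis by (simp add: hardy_functional_def a_def)
  qed
  finally show ?thesis by (simp add: H_prenorm_def calH_prenorm_hardy_class[OF cl \<Omega>])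
qed

theorem proposition2p1:
  fixes \<Omega> :: "(real ^ 'n) set"
  assumes "CARD('n) \<ge> 3"
    and "open \<Omega>" and "connected \<Omega>" and "bounded \<Omega>" and "0 \<in> \<Omega>"
  shows "H_space \<Omega> = calH_space \<Omega> \<and> (\<forall>u\<in>H_space \<Omega>. H_norm \<Omega> u = calH_norm \<Omega> u)"
proof -
  let ?q = "calH_prenorm \<Omega>" and ?Z = "test_functions (\<Omega> - {0})"
  have N: "DIM(real ^ 'n) \<ge> 3" using assms(1) by simp
  have \<Omega>: "\<Omega> \<in> sets borel" using assms(2) by simp
  have dense: "completion_space X ?q \<Omega> = completion_space ?Z ?q \<Omega>"
    "completion_norm X ?q \<Omega> u = completion_norm ?Z ?q \<Omega> u"
    if "X \<subseteq> hardy_class \<Omega>" "?Z \<subseteq> X" for X u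
    by (rule completion_dense_subset[of "hardy_class \<Omega>" ?q \<Omega> X ?Z, OF hardy_class_diff calH_prenorm_diff(1)[OF _ _ \<Omega>]
        calH_prenorm_diff(2)[OF _ _ \<Omega>] hardy_class_L2[OF N \<Omega>] that hardy_class_approx[OF N \<Omega>]];
        use that in blast)+
  have ZX: "?Z \<subseteq> test_functions \<Omega>" by (auto simp: test_functions_iff)
  note Z_test = dense[OF test_functions_subset_hardy_class[OF N] ZX]
  note Z_core = dense[OF calH_core_subset_hardy_class[OF N] punctured_test_functions_subset_calH_core]
  note cong = completion_cong_norm[of "test_functions \<Omega>" "H_prenorm \<Omega>" ?q \<Omega>,
      OF test_functions_diff H_prenorm_eq_calH_prenorm[OF N \<Omega>]]
  show ?thesis
    by (simp add: H_space_def calH_space_def H_norm_def calH_norm_def cong Z_test Z_core)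
qed

end
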